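(* Let $F_1=(u,v,f_1)$, $F_2=(u,v,f_2)$ be two ruled surfaces in isotropic space $I^3$ with the same top view of rulings, i.e. corresponding rulings lie in the same isotropic plane. Denote the difference surface by $V=(-v,u,f_1-f_2)$. (i) Then $V$ is a non-planar torsal ruled surface if and only if $F_1$ and $F_2$ are related by a non-trivial isotropic Minding isometry. A planar surface $V$ implies that $F_1$ and $F_2$ are congruent in $I^3$, which is called a trivial isometry. (ii) $V$ is a velocity diagram of an infinitesimal ruling preserving isometry of the middle surface $M=(u,v,(f_1+f_2)/2)$. (iii) $V$ is the tangent surface of a space curve if $F_1$ and $F_2$ are ruled surfaces of type I, a cone for type II and a non-isotropic cylinder for type III.
   Context: Isotropic space $I^3$ is $\mathbb{R}^3$ with the pseudometric given by the Euclidean distance in the top view, where the top view of $(x,y,z)$ is $(x,y)$. Isotropic lines and planes are those parallel to the $z$-axis. Isotropic congruence transformations are the volume-preserving affine maps of $\mathbb{R}^3$ that appear in the top view as Euclidean congruence transformations. The isotropic Gaussian curvature of a graph $(u,v,f(u,v))$ is $K=f_{uu}f_{vv}-f_{uv}^2$. Two surfaces with the same top view are isometric in $I^3$ if they have the same isotropic Gaussian curvature at corresponding points, i.e. at points with the same top view. An isotropic Minding isometry is an isometry in $I^3$ between ruled surfaces in which the rulings correspond to each other. Types of ruled surfaces in $I^3$: type I: the top views of the rulings are the tangents of a curve; type II: all rulings intersect a fixed isotropic line, so their top views pass through a common point; type III: all rulings are parallel to a fixed isotropic plane, so their top views are parallel lines. A ruled surface is torsal (developable) if the tangent plane is constant along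 each ruling. A non-isotropic cylinder is a cylinder whose rulings are not isotropic lines. $V=(-v,u,n)$ is a velocity diagram of an infinitesimal isometry of $F=(u,v,f)$ if the deformation $F+tV$ preserves, to first order at $t=0$, the metric of the top view and the isotropic Gaussian curvature, equivalently $f_{uu}n_{vv}-2f_{uv}n_{uv}+f_{vv}n_{uu}=0$. An infinitesimal isometry (of a ruled surface) is called ruling preserving if the corresponding velocity diagram is also a ruled surface.
   Formalization: In (i) the Minding side also requires that the twists of F_1 and F_2 along rulings never have opposite signs; "volume-preserving" means determinant +1; (ii) assumes F_1 and F_2 are Minding isometric; (iii) assumes V is torsal. *)

theory Defs
  imports "HOL-Analysis.Analysis"
begin

text \<open>To be used for open \<open>S\<close>: derivatives are full, not relative to \<open>S\<close>.\<close>

primrec Ck_on :: "nat \<Rightarrow> ('a::euclidean_space \<Rightarrow> 'b::real_normed_vector) \<Rightarrow> 'a set \<Rightarrow> bool" where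
  "Ck_on 0 f S \<longleftrightarrow> continuous_on S f"
| "Ck_on (Suc k) f S \<longleftrightarrow> (\<forall>x\<in>S. f differentiable (at x)) \<and>
     (\<forall>b\<in>Basis. Ck_on k (\<lambda>x. frechet_derivative f (at x) b) S)"

definition partial :: "2 \<Rightarrow> (real^2 \<Rightarrow> real) \<Rightarrow> real^2 \<Rightarrow> real" where
  "partial i f q = frechet_derivative f (at q) (axis i 1)"

definition hess :: "(real^2 \<Rightarrow> real) \<Rightarrow> real^2 \<Rightarrow> real^2 \<Rightarrow> real^2 \<Rightarrow> real" where
  "hess f q h k = (\<Sum>i\<in>UNIV. \<Sum>j\<in>UNIV. h $ i * k $ j * partial j (partial i f) q)"

definition rot :: "real^2 \<Rightarrow> real^2" where
  "rot q = vector [- (q $ 2), q $ 1]"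

section \<open>Isotropic space\<close>

definition top_view :: "real^3 \<Rightarrow> real^2" where
  "top_view x = vector [x $ 1, x $ 2]"

definition graph :: "(real^2 \<Rightarrow> real) \<Rightarrow> real^2 \<Rightarrow> real^3" where
  "graph f q = vector [q $ 1, q $ 2, f q]"

definition difference_surface :: "(real^2 \<Rightarrow> real) \<Rightarrow> (real^2 \<Rightarrow> real) \<Rightarrow> real^2 \<Rightarrow> real^3" where
  "difference_surface f g q = vector [- (q $ 2), q $ 1, f q - g q]"

text \<open>Volume is understood as oriented volume (determinant 1, not merely of modulus 1). Hence the
  reflection that changes the sign of the third coordinate alone is not a congruence; otherwise the
  graphs of \<open>u\<^sup>2\<close> and \<open>-u\<^sup>2\<close> would be trivially isometric although their difference surface is
  torsal and not planar.\<close>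

definition isotropic_congruence :: "(real^3 \<Rightarrow> real^3) \<Rightarrow> bool" where
  "isotropic_congruence \<phi> \<longleftrightarrow>
     (\<exists>(A::real^3^3) b. (\<forall>x. \<phi> x = A *v x + b) \<and> det A = 1) \<and>
     (\<exists>g::real^2 \<Rightarrow> real^2. (\<forall>x y. dist (g x) (g y) = dist x y) \<and>
        (\<forall>x. top_view (\<phi> x) = g (top_view x)))"

definition graph_curvature :: "(real^2 \<Rightarrow> real) \<Rightarrow> real^2 \<Rightarrow> real" where
  "graph_curvature f q =
     partial 1 (partial 1 f) q * partial 2 (partial 2 f) q - (partial 2 (partial 1 f) q)\<^sup>2"

text \<open>The same curvature for a surface \<open>X\<close> parametrized over \<open>D\<close> with injective top view:
  rewrite \<open>X\<close> as the graph of a function on its own top view.\<close>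

definition isotropic_curvature :: "(real^2) set \<Rightarrow> (real^2 \<Rightarrow> real^3) \<Rightarrow> real^2 \<Rightarrow> real" where
  "isotropic_curvature D X q =
     graph_curvature (\<lambda>y. X (inv_into D (top_view \<circ> X) y) $ 3) (top_view (X q))"

definition isotropically_isometric ::
    "(real^2) set \<Rightarrow> (real^2 \<Rightarrow> real) \<Rightarrow> (real^2 \<Rightarrow> real) \<Rightarrow> bool" where
  "isotropically_isometric D f g \<longleftrightarrow> (\<forall>q\<in>D. graph_curvature f q = graph_curvature g q)"

text \<open>Triviality concerns the point correspondence given by equal top views, not just congruence of
  the two point sets.\<close>

definition trivially_isometric ::
    "(real^2) set \<Rightarrow> (real^2 \<Rightarrow> real) \<Rightarrow> (real^2 \<Rightarrow> real) \<Rightarrow> bool" where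
  "trivially_isometric D f g \<longleftrightarrow> isotropically_isometric D f g \<and>
     (\<exists>\<phi>. isotropic_congruence \<phi> \<and> (\<forall>q\<in>D. \<phi> (graph f q) = graph g q))"

definition velocity_diagram ::
    "(real^2) set \<Rightarrow> (real^2 \<Rightarrow> real^3) \<Rightarrow> (real^2 \<Rightarrow> real^3) \<Rightarrow> bool" where
  "velocity_diagram D F V \<longleftrightarrow> (\<forall>q\<in>D.
     (\<forall>h. ((\<lambda>\<tau>. (norm (frechet_derivative (\<lambda>x. top_view (F x + \<tau> *\<^sub>R V x)) (at q) h))\<^sup>2)
        has_real_derivative 0) (at 0)) \<and>
     ((\<lambda>\<tau>. isotropic_curvature D (\<lambda>x. F x + \<tau> *\<^sub>R V x) q) has_real_derivative 0) (at 0))"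

section \<open>Ruled surfaces\<close>

text \<open>The top views of the rulings are the segments \<open>p s + t e s\<close> with \<open>(s, t) \<in> \<Omega>\<close>. They cover
  their union simply, so that surfaces with this top view of rulings are graphs.\<close>

definition ruling :: "(real \<Rightarrow> real^2) \<Rightarrow> (real \<Rightarrow> real^2) \<Rightarrow> (real \<times> real) set \<Rightarrow> real \<Rightarrow> (real^2) set" where
  "ruling p e \<Omega> s = {p s + t *\<^sub>R e s | t. (s, t) \<in> \<Omega>}"

definition ruled_domain :: "(real \<Rightarrow> real^2) \<Rightarrow> (real \<Rightarrow> real^2) \<Rightarrow> (real \<times> real) set \<Rightarrow> (real^2) set" where
  "ruled_domain p e \<Omega> = (\<Union>s\<in>fst ` \<Omega>. ruling p e \<Omega> s)"

definition ruling_family :: "(real \<Rightarrow> real^2) \<Rightarrow> (real \<Rightarrow> real^2) \<Rightarrow> (real \<times> real) set \<Rightarrow> bool" where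
  "ruling_family p e \<Omega> \<longleftrightarrow> open \<Omega> \<and> connected \<Omega> \<and> \<Omega> \<noteq> {} \<and>
     (\<forall>s. is_interval {t. (s, t) \<in> \<Omega>}) \<and>
     Ck_on 1 p (fst ` \<Omega>) \<and> Ck_on 1 e (fst ` \<Omega>) \<and> (\<forall>s\<in>fst ` \<Omega>. e s \<noteq> 0) \<and>
     inj_on (\<lambda>(s, t). p s + t *\<^sub>R e s) \<Omega>"

text \<open>Below, \<open>I\<close> is the index set of the rulings, and \<open>L s\<close> is the piece of the ruling with index
  \<open>s\<close> that lies on the surface, or the top view of that piece.\<close>

definition ruled :: "real set \<Rightarrow> (real \<Rightarrow> (real^2) set) \<Rightarrow> (real^2 \<Rightarrow> real^3) \<Rightarrow> bool" where
  "ruled I L X \<longleftrightarrow> (\<forall>s\<in>I. collinear (X ` L s))"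

definition tangent_plane :: "(real^2 \<Rightarrow> real^3) \<Rightarrow> real^2 \<Rightarrow> (real^3) set" where
  "tangent_plane X q = range (\<lambda>h. X q + frechet_derivative X (at q) h)"

definition torsal :: "real set \<Rightarrow> (real \<Rightarrow> (real^2) set) \<Rightarrow> (real^2 \<Rightarrow> real^3) \<Rightarrow> bool" where
  "torsal I L X \<longleftrightarrow> ruled I L X \<and>
     (\<forall>s\<in>I. \<forall>q\<in>L s. \<forall>q'\<in>L s. tangent_plane X q = tangent_plane X q')"

definition tangent_line :: "(real \<Rightarrow> real^'n) \<Rightarrow> real \<Rightarrow> (real^'n) set" where
  "tangent_line c s = range (\<lambda>r. c s + r *\<^sub>R vector_derivative c (at s))"

definition tangents_of_curve :: "real set \<Rightarrow> (real \<Rightarrow> (real^'n) set) \<Rightarrow> bool" where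
  "tangents_of_curve I L \<longleftrightarrow> (\<exists>c. Ck_on 2 c I \<and>
     (\<forall>s\<in>I. vector_derivative c (at s) \<noteq> 0 \<and> L s \<subseteq> tangent_line c s))"

definition concurrent_lines :: "real set \<Rightarrow> (real \<Rightarrow> (real^'n) set) \<Rightarrow> bool" where
  "concurrent_lines I L \<longleftrightarrow> (\<exists>z. \<forall>s\<in>I. z \<in> affine hull (L s))"

definition parallel_to :: "real set \<Rightarrow> (real \<Rightarrow> (real^'n) set) \<Rightarrow> real^'n \<Rightarrow> bool" where
  "parallel_to I L w \<longleftrightarrow> w \<noteq> 0 \<and> (\<forall>s\<in>I. \<exists>z. L s \<subseteq> range (\<lambda>r. z + r *\<^sub>R w))"

definition type_I :: "real set \<Rightarrow> (real \<Rightarrow> (real^2) set) \<Rightarrow> bool" where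
  "type_I I L \<longleftrightarrow> tangents_of_curve I L"

definition type_II :: "real set \<Rightarrow> (real \<Rightarrow> (real^2) set) \<Rightarrow> bool" where
  "type_II I L \<longleftrightarrow> concurrent_lines I L"

definition type_III :: "real set \<Rightarrow> (real \<Rightarrow> (real^2) set) \<Rightarrow> bool" where
  "type_III I L \<longleftrightarrow> (\<exists>w. parallel_to I L w)"

definition tangent_surface :: "real set \<Rightarrow> (real \<Rightarrow> (real^2) set) \<Rightarrow> (real^2 \<Rightarrow> real^3) \<Rightarrow> bool" where
  "tangent_surface I L X \<longleftrightarrow> tangents_of_curve I (\<lambda>s. X ` L s)"

definition cone_surface :: "real set \<Rightarrow> (real \<Rightarrow> (real^2) set) \<Rightarrow> (real^2 \<Rightarrow> real^3) \<Rightarrow> bool" where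
  "cone_surface I L X \<longleftrightarrow> ruled I L X \<and> concurrent_lines I (\<lambda>s. X ` L s)"

definition nonisotropic_cylinder :: "real set \<Rightarrow> (real \<Rightarrow> (real^2) set) \<Rightarrow> (real^2 \<Rightarrow> real^3) \<Rightarrow> bool" where
  "nonisotropic_cylinder I L X \<longleftrightarrow> (\<exists>w. parallel_to I (\<lambda>s. X ` L s) w \<and> top_view w \<noteq> 0)"

definition minding_isometric ::
    "real set \<Rightarrow> (real \<Rightarrow> (real^2) set) \<Rightarrow> (real^2) set \<Rightarrow> (real^2 \<Rightarrow> real) \<Rightarrow> (real^2 \<Rightarrow> real) \<Rightarrow> bool" where
  "minding_isometric I L D f g \<longleftrightarrow>
     ruled I L (graph f) \<and> ruled I L (graph g) \<and> isotropically_isometric D f g"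

definition ruling_preserving_velocity_diagram ::
    "real set \<Rightarrow> (real \<Rightarrow> (real^2) set) \<Rightarrow> (real^2) set \<Rightarrow> (real^2 \<Rightarrow> real^3) \<Rightarrow> (real^2 \<Rightarrow> real^3) \<Rightarrow> bool" where
  "ruling_preserving_velocity_diagram I L D F V \<longleftrightarrow>
     ruled I L F \<and> velocity_diagram D F V \<and> ruled I L V"

text \<open>Along a ruling with top view direction \<open>e\<close>, the tangent plane of a ruled graph of \<open>f\<close> turns at
  the rate \<open>hess f q e (rot e)\<close>, up to a positive factor, and its curvature is minus the square of
  that rate if \<open>e\<close> is a unit vector. So the curvature determines the rate only up to sign: the
  graphs of \<open>u v\<close> and \<open>-u v\<close> have the same curvature and the same top view of rulings, but their
  difference surface is not torsal. The following condition excludes opposite signs; it does not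
  depend on the choice of \<open>e\<close>.\<close>

definition equal_winding ::
    "(real \<Rightarrow> real^2) \<Rightarrow> (real \<Rightarrow> real^2) \<Rightarrow> (real \<times> real) set \<Rightarrow> (real^2 \<Rightarrow> real) \<Rightarrow> (real^2 \<Rightarrow> real) \<Rightarrow> bool" where
  "equal_winding p e \<Omega> f g \<longleftrightarrow> (\<forall>s\<in>fst ` \<Omega>. \<forall>q\<in>ruling p e \<Omega> s.
     0 \<le> hess f q (e s) (rot (e s)) * hess g q (e s) (rot (e s)))"

end

theory Submission
  imports Defs
begin

text \<open>Let \<open>g = f1 - f2\<close>, and let \<open>e\<close> be the direction of a ruling in the top view.

  A ruled graph is affine along each ruling, so \<open>e\<close> is an asymptotic direction of its Hessian form. In the
  orthogonal frame \<open>e\<close>, \<open>rot e\<close> the Hessian determinant then reduces to minus the square of the mixed entry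
  \<open>hess f q e (rot e)\<close>, up to the factor \<open>(e \<bullet> e)\<^sup>2\<close> (\<open>curvature_along_asymptotic\<close>). Hence \<open>f1\<close> and \<open>f2\<close>
  are isometric iff their mixed entries agree up to sign, and \<open>equal_winding\<close> removes the sign. On the other
  hand the tangent plane of the difference surface at \<open>q\<close> is determined by the gradient of \<open>g\<close> along the
  ruling (\<open>torsal_difference_iff\<close>), and this gradient is constant on the ruling iff the mixed entry of \<open>g\<close>
  vanishes there (\<open>gradient_constant_iff\<close>), that is, iff those of \<open>f1\<close> and \<open>f2\<close> are equal. Planarity of the difference
  surface and congruence of the graphs both say that \<open>g\<close> is affine (\<open>coplanar_difference_iff\<close>,
  \<open>trivially_isometric_iff\<close>).

  For the velocity diagram, moving the point \<open>(q, (f1 q + f2 q) / 2)\<close> by \<open>\<tau>\<close> times \<open>(rot q, g q)\<close> applies to the top view the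
  similarity \<open>q + \<tau> rot q\<close>, which is an isometry to first order. The Hessian determinant of the moved graph is
  \<open>det (A + \<tau> B) / (1 + \<tau>\<^sup>2)\<^sup>2\<close>, with \<open>A\<close> and \<open>B\<close> the Hessians of \<open>(f1 + f2) / 2\<close> and \<open>f1 - f2\<close>. Its linear
  coefficient in \<open>\<tau>\<close> is the polarization of the quadratic form \<open>det\<close> at the half sum and the difference,
  that is, \<open>det\<close> of the Hessian of \<open>f1\<close> minus that of \<open>f2\<close>, and this vanishes by isometry.

  If the difference surface is torsal, the tangent planes along its rulings form a one-parameter family
  \<open>g q = N s \<bullet> q + k s\<close>. Differentiating this in \<open>s\<close> along a curve that crosses the rulings, the velocity of
  \<open>q\<close> cancels because \<open>N s\<close> is the gradient of \<open>g\<close>, and the envelope equations \<open>N' \<bullet> e = 0\<close> and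
  \<open>N' \<bullet> p + k' = 0\<close> are left (\<open>constant_gradient_envelope\<close>), so
  \<open>N' \<bullet> x + k' = 0\<close> for every \<open>x\<close> on the whole line that carries the ruling. Evaluated at the point of contact
  with the curve enveloped by the top views, at the common point, or in the common direction of the top
  views, they show that the lifted rulings are the tangents of a space curve, pass through one point, or
  have one direction (\<open>envelope_types\<close>).\<close>

section \<open>Second derivatives of functions on the plane\<close>

definition gradient :: "(real^2 \<Rightarrow> real) \<Rightarrow> real^2 \<Rightarrow> real^2" where
  "gradient f q = (\<chi> i. partial i f q)"

definition hessian :: "(real^2 \<Rightarrow> real) \<Rightarrow> real^2 \<Rightarrow> real^2^2" where
  "hessian f q = (\<chi> i j. partial j (partial i f) q)"

text \<open>A function together with candidates for its gradient and its Hessian matrix on a region. Second derivatives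
  of sums and compositions are computed by exhibiting such candidates; on an open region they are forced to
  be the iterated partial derivatives (\<open>second_order_on_hessian\<close>).\<close>

definition second_order_on ::
    "(real^2) set \<Rightarrow> (real^2 \<Rightarrow> real) \<Rightarrow> (real^2 \<Rightarrow> real^2) \<Rightarrow> (real^2 \<Rightarrow> real^2^2) \<Rightarrow> bool" where
  "second_order_on D f G H \<longleftrightarrow> (\<forall>q\<in>D.
     (f has_derivative (\<lambda>h. G q \<bullet> h)) (at q) \<and> (G has_derivative (\<lambda>h. H q *v h)) (at q))"

lemma second_order_onD:
  assumes "second_order_on D f G H" "q \<in> D"
  shows "(f has_derivative (\<lambda>h. G q \<bullet> h)) (at q)" "(G has_derivative (\<lambda>h. H q *v h)) (at q)"
  using assms by (auto simp: second_order_on_def)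

lemma partial_eqI: "(f has_derivative f') (at q) \<Longrightarrow> partial i f q = f' (axis i 1)"
  by (metis frechet_derivative_at partial_def)

lemma inner_2: "(x::real^2) \<bullet> y = x $ 1 * y $ 1 + x $ 2 * y $ 2"
  by (simp add: inner_vec_def sum_2)

lemma differentiable_imp_gradient:
  assumes "f differentiable (at q)"
  shows "(f has_derivative (\<lambda>h. gradient f q \<bullet> h)) (at q)"
proof -
  have der: "(f has_derivative frechet_derivative f (at q)) (at q)"
    using assms by (simp add: frechet_derivative_works)
  then interpret bounded_linear "frechet_derivative f (at q)"
    by (rule has_derivative_bounded_linear)
  have "frechet_derivative f (at q) h = gradient f q \<bullet> h" for h
  proof -
    have "h = h $ 1 *\<^sub>R axis 1 1 + h $ 2 *\<^sub>R axis 2 1"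
      by (simp add: vec_eq_iff forall_2 axis_def)
    then have "frechet_derivative f (at q) h = frechet_derivative f (at q) (h $ 1 *\<^sub>R axis 1 1 + h $ 2 *\<^sub>R axis 2 1)"
      by simp
    then show ?thesis
      by (simp add: add scaleR gradient_def partial_def inner_2)
  qed
  then have "frechet_derivative f (at q) = (\<lambda>h. gradient f q \<bullet> h)"
    by blast
  with der show ?thesis
    by simp
qed

lemma Ck_on_2_second_order:
  assumes "Ck_on 2 f D"
  shows "second_order_on D f (gradient f) (hessian f)" "continuous_on D (hessian f)"
proof -
  have ax: "axis i (1::real) \<in> Basis" for i :: 2
    by simp
  have df: "f differentiable (at q)" if "q \<in> D" for q
    using assms that by (simp add: numeral_2_eq_2)
  have dp: "partial i f differentiable (at q)" if "q \<in> D" for q i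
    using assms that ax[of i] unfolding partial_def[abs_def]
    by (simp add: numeral_2_eq_2)
  have cont: "continuous_on D (partial j (partial i f))" for i j
    using assms ax[of i] ax[of j] unfolding partial_def[abs_def]
    by (simp add: numeral_2_eq_2)
  have "(gradient f has_derivative (\<lambda>h. hessian f q *v h)) (at q)" if "q \<in> D" for q
  proof -
    have "(partial i f has_derivative (\<lambda>h. (hessian f q *v h) $ i)) (at q)" for i
      using differentiable_imp_gradient[OF dp[OF that, of i]]
      by (simp add: gradient_def hessian_def matrix_vector_mult_def inner_vec_def)
    then show ?thesis
      unfolding gradient_def[abs_def] by (subst has_derivative_componentwise_within)
        (auto simp: Basis_vec_def inner_axis)
  qed
  then show "second_order_on D f (gradient f) (hessian f)"
    using differentiable_imp_gradient[OF df] by (simp add: second_order_on_def)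
  show "continuous_on D (hessian f)"
    unfolding hessian_def[abs_def] by (intro continuous_on_vec_lambda cont)
qed

lemma second_order_on_hessian:
  assumes "open D" "second_order_on D f G H" "q \<in> D"
  shows "hessian f q = H q"
proof -
  have p: "partial i f x = G x $ i" if "x \<in> D" for x i
    using partial_eqI[OF second_order_onD(1)[OF assms(2) that]] by (simp add: inner_axis)
  have "((\<lambda>x. G x $ i) has_derivative (\<lambda>h. (H q *v h) $ i)) (at q)" for i
    using second_order_onD(2)[OF assms(2,3)] by (rule bounded_linear.has_derivative[OF bounded_linear_vec_nth])
  then have "(partial i f has_derivative (\<lambda>h. (H q *v h) $ i)) (at q)" for i
    using has_derivative_transform_within_open[OF _ assms(1,3)] p by (metis (no_types, lifting))
  then have "partial j (partial i f) q = (H q *v axis j 1) $ i" for i j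
    by (rule partial_eqI)
  then show "hessian f q = H q"
    by (simp add: hessian_def vec_eq_iff matrix_vector_mult_basis column_def)
qed

lemma second_order_on_cong:
  assumes "open D" and eq: "\<And>q. q \<in> D \<Longrightarrow> g q = f q" and "second_order_on D f G H"
  shows "second_order_on D g G H"
  using assms(3) unfolding second_order_on_def
  by (auto intro: has_derivative_transform_within_open[OF _ assms(1) _ eq[symmetric]])

lemma second_order_on_add:
  assumes "second_order_on D f G H" "second_order_on D f' G' H'"
  shows "second_order_on D (\<lambda>q. f q + c * f' q) (\<lambda>q. G q + c *\<^sub>R G' q) (\<lambda>q. H q + c *\<^sub>R H' q)"
  using assms unfolding second_order_on_def
  by (auto intro!: derivative_eq_intros simp: inner_simps matrix_vector_mult_add_rdistrib scaleR_matrix_vector_assoc)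

lemma second_order_on_affine: "second_order_on D (\<lambda>q. a \<bullet> q + c) (\<lambda>q. a) (\<lambda>q. 0)"
  unfolding second_order_on_def by (auto intro!: derivative_eq_intros)

lemma second_order_on_compose:
  fixes S :: "real^2^2"
  assumes "second_order_on D f G H"
  shows "second_order_on {y. S *v y \<in> D} (\<lambda>y. f (S *v y)) (\<lambda>y. transpose S *v G (S *v y))
     (\<lambda>y. transpose S ** H (S *v y) ** S)"
  unfolding second_order_on_def
proof safe
  fix y assume y: "S *v y \<in> D"
  have S: "((\<lambda>y. S *v y) has_derivative (\<lambda>h. S *v h)) (at y)"
    by (rule bounded_linear_imp_has_derivative) simp
  have "((\<lambda>y. f (S *v y)) has_derivative (\<lambda>h. G (S *v y) \<bullet> (S *v h))) (at y)"
    using has_derivative_compose[OF S second_order_onD(1)[OF assms y]] .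
  then show "((\<lambda>y. f (S *v y)) has_derivative (\<lambda>h. (transpose S *v G (S *v y)) \<bullet> h)) (at y)"
    by (simp add: dot_lmul_matrix[symmetric])
  have "((\<lambda>y. G (S *v y)) has_derivative (\<lambda>h. H (S *v y) *v (S *v h))) (at y)"
    using has_derivative_compose[OF S second_order_onD(2)[OF assms y]] .
  then have "((\<lambda>y. transpose S *v G (S *v y)) has_derivative (\<lambda>h. transpose S *v (H (S *v y) *v (S *v h)))) (at y)"
    by (rule bounded_linear.has_derivative[OF matrix_vector_mul_bounded_linear])
  then show "((\<lambda>y. transpose S *v G (S *v y)) has_derivative
      (\<lambda>h. (transpose S ** H (S *v y) ** S) *v h)) (at y)"
    by (simp add: matrix_vector_mul_assoc matrix_mul_assoc)
qed

text \<open>The mean value theorem is applied twice, first in the direction \<open>u\<close> and then in the direction \<open>v\<close>. The left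
  side is symmetric in \<open>u\<close> and \<open>v\<close>, the right side is not visibly so; this is the source of the symmetry of
  the Hessian.\<close>

lemma second_difference:
  assumes D: "second_order_on D f G H" and h: "0 < h"
    and inD: "\<And>s r. 0 \<le> s \<Longrightarrow> s \<le> h \<Longrightarrow> 0 \<le> r \<Longrightarrow> r \<le> h \<Longrightarrow> q + s *\<^sub>R u + r *\<^sub>R v \<in> D"
  obtains s r where "0 \<le> s" "s \<le> h" "0 \<le> r" "r \<le> h"
    "f (q + h *\<^sub>R u + h *\<^sub>R v) - f (q + h *\<^sub>R u) - f (q + h *\<^sub>R v) + f q
      = h\<^sup>2 * (u \<bullet> (H (q + s *\<^sub>R u + r *\<^sub>R v) *v v))"
proof -
  define F where "F s = f (q + s *\<^sub>R u + h *\<^sub>R v) - f (q + s *\<^sub>R u + 0 *\<^sub>R v)" for s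
  have line: "((\<lambda>s. q + s *\<^sub>R u + r *\<^sub>R v) has_derivative (\<lambda>k. k *\<^sub>R u)) (at s)"
     "((\<lambda>r. q + s *\<^sub>R u + r *\<^sub>R v) has_derivative (\<lambda>k. k *\<^sub>R v)) (at r)" for s r
    by (auto intro!: derivative_eq_intros)
  have f: "((\<lambda>s. f (q + s *\<^sub>R u + r *\<^sub>R v)) has_derivative (\<lambda>k. G (q + s *\<^sub>R u + r *\<^sub>R v) \<bullet> (k *\<^sub>R u))) (at s)"
    if "0 \<le> s" "s \<le> h" "0 \<le> r" "r \<le> h" for s r
    using has_derivative_compose[OF line(1) second_order_onD(1)[OF D inD[OF that]]] .
  have G: "((\<lambda>r. G (q + s *\<^sub>R u + r *\<^sub>R v)) has_derivative (\<lambda>k. H (q + s *\<^sub>R u + r *\<^sub>R v) *v (k *\<^sub>R v))) (at r)"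
    if "0 \<le> s" "s \<le> h" "0 \<le> r" "r \<le> h" for s r
    using has_derivative_compose[OF line(2) second_order_onD(2)[OF D inD[OF that]]] .
  have "(F has_real_derivative (G (q + s *\<^sub>R u + h *\<^sub>R v) - G (q + s *\<^sub>R u + 0 *\<^sub>R v)) \<bullet> u) (at s)"
    if "0 \<le> s" "s \<le> h" for s
    unfolding F_def[abs_def] has_field_derivative_def
    using has_derivative_diff[OF f[OF that, of h] f[OF that, of 0]] h
    by (simp add: inner_diff_left right_diff_distrib[symmetric] mult_commute_abs)
  from MVT2[OF h this] obtain s where s: "0 < s" "s < h"
    "F h - F 0 = h * ((G (q + s *\<^sub>R u + h *\<^sub>R v) - G (q + s *\<^sub>R u + 0 *\<^sub>R v)) \<bullet> u)"
    by auto
  have "((\<lambda>r. G (q + s *\<^sub>R u + r *\<^sub>R v) \<bullet> u) has_real_derivative (H (q + s *\<^sub>R u + r *\<^sub>R v) *v v) \<bullet> u) (at r)"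
    if "0 \<le> r" "r \<le> h" for r
    unfolding has_field_derivative_def
    using has_derivative_inner_left[OF G[of s r], of u] s(1,2) that
    by (simp add: matrix_vector_mult_scaleR mult_commute_abs)
  from MVT2[OF h this] obtain r where r: "0 < r" "r < h"
    "G (q + s *\<^sub>R u + h *\<^sub>R v) \<bullet> u - G (q + s *\<^sub>R u + 0 *\<^sub>R v) \<bullet> u
       = h * ((H (q + s *\<^sub>R u + r *\<^sub>R v) *v v) \<bullet> u)"
    by auto
  have "F h - F 0 = h\<^sup>2 * (u \<bullet> (H (q + s *\<^sub>R u + r *\<^sub>R v) *v v))"
    using s(3) r(3) by (simp add: inner_diff_left power2_eq_square inner_commute[of u])
  moreover have "F h - F 0 = f (q + h *\<^sub>R u + h *\<^sub>R v) - f (q + h *\<^sub>R u) - f (q + h *\<^sub>R v) + f q"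
    by (simp add: F_def)
  ultimately show thesis
    using that[of s r] s r by (simp add: less_imp_le)
qed

text \<open>Schwarz's theorem: the second difference quotient tends to the value of the Hessian form at \<open>(u, v)\<close> and, by
  its symmetry, also to the value at \<open>(v, u)\<close>.\<close>

lemma hessian_symmetric:
  assumes "open D" "q \<in> D" and D: "second_order_on D f G H" and cont: "continuous_on D H"
  shows "u \<bullet> (H q *v v) = v \<bullet> (H q *v u)"
proof (rule ccontr)
  define B where "B u v x = u \<bullet> (H x *v v)" for u v x
  assume "u \<bullet> (H q *v v) \<noteq> v \<bullet> (H q *v u)"
  define \<epsilon> where "\<epsilon> = \<bar>B u v q - B v u q\<bar> / 2"
  have "\<epsilon> > 0"
    using \<open>u \<bullet> (H q *v v) \<noteq> v \<bullet> (H q *v u)\<close> by (simp add: \<epsilon>_def B_def)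
  have "continuous_on D (B u v)" for u v
    unfolding B_def[abs_def] matrix_vector_mult_def
    by (intro continuous_intros continuous_on_vec_lambda continuous_on_component cont)
  then have "isCont (B u v) q" for u v
    using assms(1,2) by (simp add: continuous_on_eq_continuous_at)
  then have near: "\<forall>\<^sub>F x in nhds q. dist (B u v x) (B u v q) < \<epsilon>" for u v
    using \<open>\<epsilon> > 0\<close> by (simp add: tendstoD isCont_def tendsto_nhds_iff continuous_at_imp_continuous_at_within)
  have "\<forall>\<^sub>F x in nhds q. x \<in> D \<and> dist (B u v x) (B u v q) < \<epsilon> \<and> dist (B v u x) (B v u q) < \<epsilon>"
    using near[of u v] near[of v u] assms(1,2) by (simp add: eventually_conj eventually_nhds_in_open)
  then obtain \<delta> where \<delta>: "\<delta> > 0"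
    "\<And>x. dist x q < \<delta> \<Longrightarrow> x \<in> D \<and> dist (B u v x) (B u v q) < \<epsilon> \<and> dist (B v u x) (B v u q) < \<epsilon>"
    by (auto simp: eventually_nhds_metric)
  \<comment> \<open>The summand 1 keeps the quotient defined when both vectors are zero.\<close>
  define h where "h = \<delta> / (norm u + norm v + 1)"
  have pos: "norm u + norm v + 1 > 0"
    using norm_ge_zero[of u] norm_ge_zero[of v] by linarith
  have h: "h > 0" "h * (norm u + norm v) < \<delta>"
    using \<delta>(1) pos by (auto simp: h_def field_simps)
  have close: "dist (q + s *\<^sub>R x + r *\<^sub>R y) q < \<delta>"
    if "0 \<le> s" "s \<le> h" "0 \<le> r" "r \<le> h" "x = u \<and> y = v \<or> x = v \<and> y = u" for s r x y
  proof -
    have "dist (q + s *\<^sub>R x + r *\<^sub>R y) q = norm (s *\<^sub>R x + r *\<^sub>R y)"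
      by (simp add: dist_norm)
    also have "\<dots> \<le> s * norm x + r * norm y"
      using norm_triangle_ineq[of "s *\<^sub>R x" "r *\<^sub>R y"] that by simp
    also have "\<dots> \<le> h * norm x + h * norm y"
      using that by (intro add_mono mult_right_mono) auto
    also have "\<dots> < \<delta>"
      using h(2) that(5) by (auto simp: algebra_simps)
    finally show ?thesis .
  qed
  obtain s r where 1: "0 \<le> s" "s \<le> h" "0 \<le> r" "r \<le> h"
    "f (q + h *\<^sub>R u + h *\<^sub>R v) - f (q + h *\<^sub>R u) - f (q + h *\<^sub>R v) + f q = h\<^sup>2 * B u v (q + s *\<^sub>R u + r *\<^sub>R v)"
    using second_difference[OF D h(1), of q u v] close \<delta>(2) unfolding B_def by metis
  obtain s' r' where 2: "0 \<le> s'" "s' \<le> h" "0 \<le> r'" "r' \<le> h"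
    "f (q + h *\<^sub>R v + h *\<^sub>R u) - f (q + h *\<^sub>R v) - f (q + h *\<^sub>R u) + f q = h\<^sup>2 * B v u (q + s' *\<^sub>R v + r' *\<^sub>R u)"
    using second_difference[OF D h(1), of q v u] close \<delta>(2) unfolding B_def by metis
  have "h\<^sup>2 * B u v (q + s *\<^sub>R u + r *\<^sub>R v) = h\<^sup>2 * B v u (q + s' *\<^sub>R v + r' *\<^sub>R u)"
    using 1(5) 2(5) by (simp only: add.assoc add.commute[of "h *\<^sub>R v"])
  then have "B u v (q + s *\<^sub>R u + r *\<^sub>R v) = B v u (q + s' *\<^sub>R v + r' *\<^sub>R u)"
    using h(1) by simp
  moreover have "dist (B u v (q + s *\<^sub>R u + r *\<^sub>R v)) (B u v q) < \<epsilon>"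
    using \<delta>(2) close[OF 1(1-4)] by blast
  moreover have "dist (B v u (q + s' *\<^sub>R v + r' *\<^sub>R u)) (B v u q) < \<epsilon>"
    using \<delta>(2) close[OF 2(1-4)] by blast
  ultimately show False
    unfolding \<epsilon>_def dist_real_def by (auto simp: abs_if split: if_splits)
qed

section \<open>Curvature and asymptotic directions\<close>

lemma symmetric_matrix_entry:
  fixes M :: "'a^'n^'n"
  assumes "transpose M = M"
  shows "M $ i $ j = M $ j $ i"
proof -
  have "transpose M $ i $ j = M $ j $ i"
    by (simp add: transpose_def)
  then show ?thesis
    by (simp add: assms)
qed

text \<open>Expressed as a determinant, the curvature is multiplicative under linear changes of the top view.\<close>

lemma graph_curvature_eq_det:
  assumes "open D" "second_order_on D f G H" "q \<in> D" "transpose (H q) = H q"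
  shows "graph_curvature f q = det (H q)"
proof -
  have "graph_curvature f q = hessian f q $ 1 $ 1 * hessian f q $ 2 $ 2 - (hessian f q $ 1 $ 2)\<^sup>2"
    by (simp add: graph_curvature_def hessian_def)
  moreover have "H q $ 2 $ 1 = H q $ 1 $ 2"
    using symmetric_matrix_entry[OF assms(4)] .
  ultimately show ?thesis
    using second_order_on_hessian[OF assms(1-3)] by (simp add: det_2 power2_eq_square)
qed

lemma hess_eq_inner: "hess f q h k = h \<bullet> (hessian f q *v k)"
  by (simp add: hess_def hessian_def inner_2 sum_2 matrix_vector_mult_def algebra_simps)

lemma Ck_on_2_symmetric:
  assumes "open D" "q \<in> D" "Ck_on 2 f D"
  shows "hess f q h k = hess f q k h" "transpose (hessian f q) = hessian f q"
proof -
  show *: "hess f q h k = hess f q k h" for h k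
    unfolding hess_eq_inner
    using hessian_symmetric[OF assms(1,2) Ck_on_2_second_order[OF assms(3)]] .
  have "hessian f q $ 1 $ 2 = hessian f q $ 2 $ 1"
    using *[of "axis 1 1" "axis 2 1"]
    by (simp add: hess_eq_inner inner_axis' matrix_vector_mult_basis column_def)
  then show "transpose (hessian f q) = hessian f q"
    by (simp add: vec_eq_iff forall_2 transpose_def)
qed

lemma Ck_on_2_graph_curvature:
  assumes "open D" "q \<in> D" "Ck_on 2 f D"
  shows "graph_curvature f q = det (hessian f q)"
  using graph_curvature_eq_det[OF assms(1) Ck_on_2_second_order(1)[OF assms(3)] assms(2)]
    Ck_on_2_symmetric(2)[OF assms] by simp

lemma rot_simps [simp]: "rot q $ 1 = - q $ 2" "rot q $ 2 = q $ 1"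
  by (simp_all add: rot_def)

text \<open>In the orthogonal frame \<open>d\<close>, \<open>rot d\<close>, whose vectors both have squared length \<open>d \<bullet> d\<close>, the Hessian form has
  a vanishing diagonal entry, so that only the mixed entry contributes to the determinant.\<close>

lemma curvature_along_asymptotic:
  assumes "open D" "q \<in> D" "Ck_on 2 f D" "hess f q d d = 0"
  shows "graph_curvature f q * (d \<bullet> d)\<^sup>2 = - (hess f q d (rot d))\<^sup>2"
proof -
  define a b c x y where "a = hessian f q $ 1 $ 1" and "b = hessian f q $ 1 $ 2"
    and "c = hessian f q $ 2 $ 2" and "x = d $ 1" and "y = d $ 2"
  note ab = a_def[symmetric] b_def[symmetric] c_def[symmetric] x_def[symmetric] y_def[symmetric]
  have s: "hessian f q $ 2 $ 1 = b"
    using symmetric_matrix_entry[OF Ck_on_2_symmetric(2)[OF assms(1-3)]] by (simp add: b_def)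
  have 0: "x * (a * x + b * y) + y * (b * x + c * y) = 0"
    using assms(4) by (simp add: hess_eq_inner inner_2 matrix_vector_mult_def sum_2 s ab)
  have "hess f q d (rot d) = x * (b * x - a * y) + y * (c * x - b * y)"
    by (simp add: hess_eq_inner inner_2 matrix_vector_mult_def sum_2 s ab)
  moreover have "graph_curvature f q = a * c - b * b"
    by (simp add: Ck_on_2_graph_curvature[OF assms(1-3)] det_2 s ab)
  moreover have "d \<bullet> d = x * x + y * y"
    by (simp add: inner_2 ab)
  \<comment> \<open>In the frame \<open>d\<close>, \<open>rot d\<close> the Hessian form has determinant \<open>(a c - b\<^sup>2) (d \<bullet> d)\<^sup>2\<close>; the right side is the product of its diagonal entries.\<close>
  moreover have "(a * c - b * b) * (x * x + y * y)\<^sup>2 + (x * (b * x - a * y) + y * (c * x - b * y))\<^sup>2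
     = (x * (a * x + b * y) + y * (b * x + c * y)) * (y * (a * y - b * x) - x * (b * y - c * x))"
    by (simp add: power2_eq_square algebra_simps)
  ultimately show ?thesis
    using 0 by simp
qed

lemma Ck_on_2_diff_second_order:
  assumes "Ck_on 2 f D" "Ck_on 2 g D"
  shows "second_order_on D (\<lambda>q. f q - g q) (\<lambda>q. gradient f q - gradient g q) (\<lambda>q. hessian f q - hessian g q)"
  using second_order_on_add[OF assms[THEN Ck_on_2_second_order(1)], of "-1"] by simp

section \<open>The infinitesimal isometry of the middle surface\<close>

text \<open>Matrix of \<open>q + \<tau> rot q\<close>, a rotation followed by a scaling with factor \<open>sqrt (1 + \<tau>\<^sup>2)\<close>: the effect of the
  deformation on the top view.\<close>

definition turn :: "real \<Rightarrow> real^2^2" where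
  "turn \<tau> = vector [vector [1, - \<tau>], vector [\<tau>, 1]]"

lemma turn_mult: "turn \<tau> *v x = x + \<tau> *\<^sub>R rot x"
  by (simp add: turn_def vec_eq_iff forall_2 matrix_vector_mult_def sum_2)

lemma top_view_turned:
  "top_view (graph f x + \<tau> *\<^sub>R difference_surface g1 g2 x) = turn \<tau> *v x"
  by (simp add: turn_mult vec_eq_iff forall_2 top_view_def graph_def difference_surface_def)

lemma norm_turn_mult: "(norm (turn \<tau> *v x))\<^sup>2 = (1 + \<tau>\<^sup>2) * (norm x)\<^sup>2"
  unfolding power2_norm_eq_inner inner_2 turn_mult by (simp add: power2_eq_square algebra_simps)

text \<open>The inverse of \<open>turn \<tau>\<close>: such a matrix is a scalar multiple of an orthogonal one.\<close>

definition unturn :: "real \<Rightarrow> real^2^2" where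
  "unturn \<tau> = inverse (1 + \<tau>\<^sup>2) *\<^sub>R transpose (turn \<tau>)"

lemma
  shows unturn_turn: "unturn \<tau> *v (turn \<tau> *v x) = x"
    and turn_unturn: "turn \<tau> *v (unturn \<tau> *v x) = x"
    and det_unturn: "det (unturn \<tau>) = inverse (1 + \<tau>\<^sup>2)"
proof -
  have nz: "1 + \<tau>\<^sup>2 \<noteq> 0"
    using zero_le_power2[of \<tau>] by linarith
  have mult: "unturn \<tau> *v y = inverse (1 + \<tau>\<^sup>2) *\<^sub>R (y - \<tau> *\<^sub>R rot y)" for y
    unfolding unturn_def scaleR_matrix_vector_assoc[symmetric]
    by (simp add: turn_def vec_eq_iff forall_2 matrix_vector_mult_def sum_2 transpose_def)
  have "turn \<tau> *v x - \<tau> *\<^sub>R rot (turn \<tau> *v x) = (1 + \<tau>\<^sup>2) *\<^sub>R x"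
    by (simp add: turn_mult vec_eq_iff forall_2 power2_eq_square algebra_simps)
  with nz show "unturn \<tau> *v (turn \<tau> *v x) = x"
    by (simp add: mult)
  have "turn \<tau> *v (x - \<tau> *\<^sub>R rot x) = (1 + \<tau>\<^sup>2) *\<^sub>R x"
    by (simp add: turn_mult vec_eq_iff forall_2 power2_eq_square algebra_simps)
  with nz show "turn \<tau> *v (unturn \<tau> *v x) = x"
    by (simp add: mult matrix_vector_mult_scaleR)
  define k where "k = inverse (1 + \<tau>\<^sup>2)"
  have "det (unturn \<tau>) = k * (k * (1 + \<tau>\<^sup>2))"
    unfolding unturn_def k_def[symmetric]
    by (simp add: turn_def det_2 transpose_def power2_eq_square algebra_simps)
  also have "k * (1 + \<tau>\<^sup>2) = 1"
    using nz by (simp add: k_def)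
  finally show "det (unturn \<tau>) = inverse (1 + \<tau>\<^sup>2)"
    by (simp add: k_def)
qed

text \<open>The deformed surface is the graph of \<open>(f + \<tau> (g1 - g2)) \<circ> unturn \<tau>\<close>. By the chain rule its Hessian is
  \<open>S\<^sup>T (Hf + \<tau> Hg) S\<close> with \<open>S = unturn \<tau>\<close>, and \<open>det S = 1 / (1 + \<tau>\<^sup>2)\<close>.\<close>

lemma turned_curvature:
  assumes D: "open D" "q \<in> D" and f: "second_order_on D f Gf Hf" "transpose (Hf q) = Hf q"
    and g: "second_order_on D (\<lambda>x. g1 x - g2 x) Gg Hg" "transpose (Hg q) = Hg q"
  shows "isotropic_curvature D (\<lambda>x. graph f x + \<tau> *\<^sub>R difference_surface g1 g2 x) q
    = det (Hf q + \<tau> *\<^sub>R Hg q) / (1 + \<tau>\<^sup>2)\<^sup>2"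
proof -
  let ?X = "\<lambda>x. graph f x + \<tau> *\<^sub>R difference_surface g1 g2 x" and ?S = "unturn \<tau>" and ?R = "turn \<tau>"
  let ?D = "{y. ?S *v y \<in> D}" and ?h = "\<lambda>x. f x + \<tau> * (g1 x - g2 x)"
  have top: "top_view \<circ> ?X = (\<lambda>x. ?R *v x)"
    by (simp add: fun_eq_iff top_view_turned)
  have inj: "inj_on (\<lambda>x. ?R *v x) D"
    by (metis inj_onI unturn_turn)
  have "open ?D"
    using open_vimage[OF D(1), of "\<lambda>y. ?S *v y"]
    by (simp add: vimage_def linear_continuous_on)
  have eq: "?X (inv_into D (top_view \<circ> ?X) y) $ 3 = ?h (?S *v y)" if "y \<in> ?D" for y
  proof -
    have "inv_into D (\<lambda>x. ?R *v x) y = ?S *v y"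
      using inv_into_f_eq[OF inj, of "?S *v y" y] that by (simp add: turn_unturn)
    then show ?thesis
      unfolding top by (simp add: graph_def difference_surface_def)
  qed
  have "second_order_on ?D (\<lambda>y. ?h (?S *v y)) (\<lambda>y. transpose ?S *v (Gf (?S *v y) + \<tau> *\<^sub>R Gg (?S *v y)))
     (\<lambda>y. transpose ?S ** (Hf (?S *v y) + \<tau> *\<^sub>R Hg (?S *v y)) ** ?S)"
    by (rule second_order_on_compose[OF second_order_on_add[OF f(1) g(1)]])
  then have 2: "second_order_on ?D (\<lambda>y. ?X (inv_into D (top_view \<circ> ?X) y) $ 3)
     (\<lambda>y. transpose ?S *v (Gf (?S *v y) + \<tau> *\<^sub>R Gg (?S *v y)))
     (\<lambda>y. transpose ?S ** (Hf (?S *v y) + \<tau> *\<^sub>R Hg (?S *v y)) ** ?S)"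
    by (rule second_order_on_cong[rotated 2]) (use \<open>open ?D\<close> eq in auto)
  have q: "?R *v q \<in> ?D" "?S *v (?R *v q) = q"
    using D(2) by (simp_all add: unturn_turn)
  have "transpose (Hf q + \<tau> *\<^sub>R Hg q) = Hf q + \<tau> *\<^sub>R Hg q"
    using f(2) g(2) by (simp add: transpose_def vec_eq_iff)
  then have "graph_curvature (\<lambda>y. ?X (inv_into D (top_view \<circ> ?X) y) $ 3) (?R *v q)
     = det (transpose ?S ** (Hf q + \<tau> *\<^sub>R Hg q) ** ?S)"
    using graph_curvature_eq_det[OF \<open>open ?D\<close> 2 q(1)]
    by (simp add: q(2) matrix_transpose_mul matrix_mul_assoc)
  also have "\<dots> = det (Hf q + \<tau> *\<^sub>R Hg q) / (1 + \<tau>\<^sup>2)\<^sup>2"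
    by (simp add: det_mul det_unturn power2_eq_square divide_inverse)
  finally show ?thesis
    by (simp add: isotropic_curvature_def top_view_turned)
qed

text \<open>Both derivatives vanish because the functions of \<open>\<tau>\<close> in question depend on \<open>\<tau>\<close> only through \<open>\<tau>\<^sup>2\<close>. For the
  curvature this uses that the linear coefficient of \<open>det (A + \<tau> B)\<close> is the difference of the curvatures of
  \<open>f1\<close> and \<open>f2\<close>.\<close>

lemma velocity_diagram_difference:
  assumes D: "open D" and f: "Ck_on 2 f1 D" "Ck_on 2 f2 D" and iso: "isotropically_isometric D f1 f2"
  shows "velocity_diagram D (graph (\<lambda>q. (f1 q + f2 q) / 2)) (difference_surface f1 f2)"
  unfolding velocity_diagram_def
proof (intro ballI conjI allI)
  fix q h assume q: "q \<in> D"
  show "((\<lambda>\<tau>. (norm (frechet_derivative (\<lambda>x. top_view (graph (\<lambda>q. (f1 q + f2 q) / 2) x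
      + \<tau> *\<^sub>R difference_surface f1 f2 x)) (at q) h))\<^sup>2) has_real_derivative 0) (at 0)"
  proof -
    have "frechet_derivative (\<lambda>x. turn \<tau> *v x) (at q) = (\<lambda>x. turn \<tau> *v x)" for \<tau>
      by (metis bounded_linear_imp_has_derivative frechet_derivative_at matrix_vector_mul_bounded_linear)
    then show ?thesis
      unfolding top_view_turned by (auto simp: norm_turn_mult intro!: derivative_eq_intros)
  qed
next
  fix q assume q: "q \<in> D"
  define A B where "A = (1/2) *\<^sub>R (hessian f1 q + hessian f2 q)" and "B = hessian f1 q - hessian f2 q"
  have sym: "transpose (hessian f1 q) = hessian f1 q" "transpose (hessian f2 q) = hessian f2 q"
    using Ck_on_2_symmetric(2)[OF D q] f by auto
  have M: "second_order_on D (\<lambda>q. (f1 q + f2 q) / 2) (\<lambda>q. (1/2) *\<^sub>R (gradient f1 q + gradient f2 q))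
     (\<lambda>q. (1/2) *\<^sub>R (hessian f1 q + hessian f2 q))"
    using second_order_on_add[OF second_order_on_affine[of _ 0 0]
        second_order_on_add[OF f[THEN Ck_on_2_second_order(1)], of 1], of "1/2"] by simp
  have "transpose A = A" "transpose B = B"
    using sym by (simp_all add: A_def B_def transpose_def vec_eq_iff)
  then have curv: "isotropic_curvature D (\<lambda>x. graph (\<lambda>q. (f1 q + f2 q) / 2) x + \<tau> *\<^sub>R difference_surface f1 f2 x) q
     = det (A + \<tau> *\<^sub>R B) / (1 + \<tau>\<^sup>2)\<^sup>2" for \<tau>
    using turned_curvature[OF D q M _ Ck_on_2_diff_second_order[OF f]] by (simp add: A_def B_def)
  have "det (hessian f1 q) = det (hessian f2 q)"
    using iso q unfolding isotropically_isometric_def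
      Ck_on_2_graph_curvature[OF D q f(1), symmetric] Ck_on_2_graph_curvature[OF D q f(2), symmetric]
    by blast
  \<comment> \<open>The polarization of \<open>det\<close> at half the sum and the difference of the two Hessians.\<close>
  then have mixed: "A$1$1 * B$2$2 + A$2$2 * B$1$1 - A$1$2 * B$2$1 - A$2$1 * B$1$2 = 0"
    by (simp add: A_def B_def det_2 algebra_simps add_divide_distrib diff_divide_distrib)
  have "det (A + \<tau> *\<^sub>R B) = det A
      + \<tau> * (A$1$1 * B$2$2 + A$2$2 * B$1$1 - A$1$2 * B$2$1 - A$2$1 * B$1$2) + \<tau>\<^sup>2 * det B" for \<tau>
    by (simp add: det_2 power2_eq_square algebra_simps)
  then have "det (A + \<tau> *\<^sub>R B) = det A + \<tau>\<^sup>2 * det B" for \<tau>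
    by (simp add: mixed)
  then show "((\<lambda>\<tau>. isotropic_curvature D (\<lambda>x. graph (\<lambda>q. (f1 q + f2 q) / 2) x
      + \<tau> *\<^sub>R difference_surface f1 f2 x) q) has_real_derivative 0) (at 0)"
    by (auto simp: curv intro!: derivative_eq_intros)
qed

section \<open>Rulings in the top view and ruled graphs\<close>

lemma ruled_domain_eq_image: "ruled_domain p e \<Omega> = (\<lambda>(s, t). p s + t *\<^sub>R e s) ` \<Omega>"
  by (force simp: ruled_domain_def ruling_def)

lemma ruling_family_differentiable:
  assumes "ruling_family p e \<Omega>" "s \<in> fst ` \<Omega>"
  shows "(p has_vector_derivative vector_derivative p (at s)) (at s)"
    "(e has_vector_derivative vector_derivative e (at s)) (at s)"
  using assms by (auto simp: ruling_family_def vector_derivative_works[symmetric])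

lemma ruling_family_nonzero: "ruling_family p e \<Omega> \<Longrightarrow> s \<in> fst ` \<Omega> \<Longrightarrow> e s \<noteq> 0"
  unfolding ruling_family_def by blast

lemma ruling_family_intervals:
  assumes "ruling_family p e \<Omega>"
  shows "open (fst ` \<Omega>)" "convex (fst ` \<Omega>)" "open {t. (s, t) \<in> \<Omega>}" "convex {t. (s, t) \<in> \<Omega>}"
proof -
  have \<Omega>: "open \<Omega>" "connected \<Omega>" "\<Omega> \<noteq> {}" "is_interval {t. (s, t) \<in> \<Omega>}"
    using assms by (auto simp: ruling_family_def)
  show "open (fst ` \<Omega>)"
    using \<Omega>(1) by (rule open_image_fst)
  show "convex (fst ` \<Omega>)"
    using connected_continuous_image[OF _ \<Omega>(2), of fst]
    by (simp add: is_interval_connected_1[symmetric] is_interval_convex_1 continuous_on_fst continuous_on_id)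
  show "open {t. (s, t) \<in> \<Omega>}"
    using open_vimage[OF \<Omega>(1), of "Pair s"] by (simp add: vimage_def continuous_intros)
  show "convex {t. (s, t) \<in> \<Omega>}"
    using \<Omega>(4) by (simp add: is_interval_convex)
qed

text \<open>The parametrization of the region by \<open>\<Omega>\<close> is injective, but its Jacobian may vanish; openness therefore
  comes from invariance of domain and not from the inverse function theorem.\<close>

lemma open_ruled_domain:
  assumes "ruling_family p e \<Omega>"
  shows "open (ruled_domain p e \<Omega>)" "ruled_domain p e \<Omega> \<noteq> {}"
proof -
  have \<Omega>: "open \<Omega>" "\<Omega> \<noteq> {}" "inj_on (\<lambda>(s, t). p s + t *\<^sub>R e s) \<Omega>"
    using assms by (auto simp: ruling_family_def)
  have cont: "continuous_on (fst ` \<Omega>) p" "continuous_on (fst ` \<Omega>) e"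
    by (rule continuous_at_imp_continuous_on, rule ballI, rule has_vector_derivative_continuous,
        erule ruling_family_differentiable[OF assms])+
  have "continuous_on \<Omega> (\<lambda>x. p (fst x))" "continuous_on \<Omega> (\<lambda>x. e (fst x))"
    using continuous_on_compose2[OF cont(1) continuous_on_fst[OF continuous_on_id]]
      continuous_on_compose2[OF cont(2) continuous_on_fst[OF continuous_on_id]] by auto
  then have "continuous_on \<Omega> (\<lambda>x. p (fst x) + snd x *\<^sub>R e (fst x))"
    by (intro continuous_intros)
  then show "open (ruled_domain p e \<Omega>)"
    unfolding ruled_domain_eq_image
    by (intro invariance_of_domain_gen) (use \<Omega> in \<open>auto simp: case_prod_unfold\<close>)
  show "ruled_domain p e \<Omega> \<noteq> {}"
    using \<Omega>(2) by (simp add: ruled_domain_eq_image)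
qed

lemma ruling_family_two_points:
  assumes "ruling_family p e \<Omega>" "(s, t) \<in> \<Omega>"
  obtains t' where "(s, t') \<in> \<Omega>" "t' \<noteq> t"
proof -
  obtain r where "r > 0" "ball t r \<subseteq> {t. (s, t) \<in> \<Omega>}"
    using ruling_family_intervals(3)[OF assms(1), of s] assms(2) openE by blast
  moreover have "t + r / 2 \<in> ball t r"
    using \<open>r > 0\<close> by (simp add: dist_real_def)
  ultimately show thesis
    using that[of "t + r / 2"] by auto
qed

text \<open>A ruling has more than one point, so only one line contains it. This relates the tangent of the
  curve in type I and the common direction in type III to the given parametrization \<open>p + t e\<close>.\<close>

lemma line_containing_ruling:
  assumes fam: "ruling_family p e \<Omega>" "s \<in> fst ` \<Omega>"
    and sub: "ruling p e \<Omega> s \<subseteq> range (\<lambda>r. a + r *\<^sub>R b)"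
  obtains \<kappa> t where "b = \<kappa> *\<^sub>R e s" "a = p s + t *\<^sub>R e s"
proof -
  obtain t where t: "(s, t) \<in> \<Omega>"
    using fam(2) by auto
  obtain t' where t': "(s, t') \<in> \<Omega>" "t' \<noteq> t"
    using ruling_family_two_points[OF fam(1) t] .
  obtain r where r: "p s + t *\<^sub>R e s = a + r *\<^sub>R b"
    using sub t by (auto simp: ruling_def)
  obtain r' where r': "p s + t' *\<^sub>R e s = a + r' *\<^sub>R b"
    using sub t' by (auto simp: ruling_def)
  have eq: "(t' - t) *\<^sub>R e s = (r' - r) *\<^sub>R b"
    using arg_cong2[OF r' r, of minus] by (simp add: scaleR_diff_left)
  have "e s \<noteq> 0"
    using ruling_family_nonzero[OF fam] .
  with eq t' have "r' \<noteq> r"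
    by auto
  then have "b = ((t' - t) / (r' - r)) *\<^sub>R e s"
    using arg_cong[OF eq, of "\<lambda>x. (1 / (r' - r)) *\<^sub>R x"] by simp
  moreover from this have "a = p s + (t - r * ((t' - t) / (r' - r))) *\<^sub>R e s"
    using r by (simp add: algebra_simps)
  ultimately show thesis
    using that by blast
qed

definition affine_along_rulings ::
    "(real \<Rightarrow> real^2) \<Rightarrow> (real \<Rightarrow> real^2) \<Rightarrow> (real \<times> real) set \<Rightarrow> (real^2 \<Rightarrow> real) \<Rightarrow> bool" where
  "affine_along_rulings p e \<Omega> f \<longleftrightarrow>
     (\<forall>s\<in>fst ` \<Omega>. \<exists>a b. \<forall>t. (s, t) \<in> \<Omega> \<longrightarrow> f (p s + t *\<^sub>R e s) = a + b * t)"

text \<open>Along a ruling the top view of a point of the graph is affine in \<open>t\<close> with a nonzero velocity, and the points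
  are collinear, so the height is affine in \<open>t\<close> as well.\<close>

lemma ruled_graph_imp_affine:
  assumes fam: "ruling_family p e \<Omega>" and ruled: "ruled (fst ` \<Omega>) (ruling p e \<Omega>) (graph f)"
  shows "affine_along_rulings p e \<Omega> f"
  unfolding affine_along_rulings_def
proof
  fix s assume s: "s \<in> fst ` \<Omega>"
  then have e: "e s \<noteq> 0"
    by (rule ruling_family_nonzero[OF fam])
  obtain t\<^sub>0 where t0: "(s, t\<^sub>0) \<in> \<Omega>"
    using s by auto
  obtain t\<^sub>1 where t1: "(s, t\<^sub>1) \<in> \<Omega>" "t\<^sub>1 \<noteq> t\<^sub>0"
    using ruling_family_two_points[OF fam t0] .
  define X where "X t = graph f (p s + t *\<^sub>R e s)" for t
  have X: "X t \<in> graph f ` ruling p e \<Omega> s" if "(s, t) \<in> \<Omega>" for t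
    using that by (auto simp: X_def ruling_def)
  obtain u where u: "\<And>x y. x \<in> graph f ` ruling p e \<Omega> s \<Longrightarrow> y \<in> graph f ` ruling p e \<Omega> s
      \<Longrightarrow> \<exists>c. x - y = c *\<^sub>R u"
    using ruled s unfolding ruled_def collinear_def by blast
  obtain c\<^sub>1 where c1: "X t\<^sub>1 - X t\<^sub>0 = c\<^sub>1 *\<^sub>R u"
    using u[OF X[OF t1(1)] X[OF t0]] by blast
  obtain i where i: "e s $ i \<noteq> 0"
    using e by (auto simp: vec_eq_iff)
  have top: "top_view (X t - X t') $ i = (t - t') * e s $ i" for t t'
    using exhaust_2[of i] by (auto simp: X_def top_view_def graph_def algebra_simps)
  have top_scale: "top_view (c *\<^sub>R u) $ i = c * top_view u $ i" for c
    using exhaust_2[of i] by (auto simp: top_view_def)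
  define w where "w = top_view u $ i"
  have w: "(t\<^sub>1 - t\<^sub>0) * e s $ i = c\<^sub>1 * w"
    using top[of t\<^sub>1 t\<^sub>0] top_scale[of c\<^sub>1] c1 by (simp add: w_def)
  then have "c\<^sub>1 \<noteq> 0" "w \<noteq> 0"
    using i t1(2) by auto
  \<comment> \<open>The slope: the line has direction \<open>u\<close>, whose top view is \<open>w / e s $ i\<close> times \<open>e s\<close>.\<close>
  define b where "b = (u $ 3) * (e s $ i) / w"
  have "f (p s + t *\<^sub>R e s) = (f (p s + t\<^sub>0 *\<^sub>R e s) - b * t\<^sub>0) + b * t" if t: "(s, t) \<in> \<Omega>" for t
  proof -
    obtain c where c: "X t - X t\<^sub>0 = c *\<^sub>R u"
      using u[OF X[OF t] X[OF t0]] by blast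
    have "(t - t\<^sub>0) * e s $ i = c * w"
      using top[of t t\<^sub>0] top_scale[of c] c by (simp add: w_def)
    then have "c = (t - t\<^sub>0) * e s $ i / w"
      using \<open>w \<noteq> 0\<close> by (simp add: field_simps)
    moreover have "f (p s + t *\<^sub>R e s) - f (p s + t\<^sub>0 *\<^sub>R e s) = c * u $ 3"
      using arg_cong[OF c, of "\<lambda>x. x $ 3"] by (simp add: X_def graph_def)
    ultimately have "f (p s + t *\<^sub>R e s) - f (p s + t\<^sub>0 *\<^sub>R e s) = b * (t - t\<^sub>0)"
      by (simp add: b_def)
    then show ?thesis
      by (simp add: algebra_simps)
  qed
  then show "\<exists>a b. \<forall>t. (s, t) \<in> \<Omega> \<longrightarrow> f (p s + t *\<^sub>R e s) = a + b * t"
    by blast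
qed

lemma ruledI:
  assumes "\<And>s. s \<in> fst ` \<Omega> \<Longrightarrow> \<exists>a b. \<forall>t. (s, t) \<in> \<Omega> \<longrightarrow> X (p s + t *\<^sub>R e s) = a + t *\<^sub>R b"
  shows "ruled (fst ` \<Omega>) (ruling p e \<Omega>) X"
  unfolding ruled_def
proof
  fix s assume "s \<in> fst ` \<Omega>"
  then obtain a b where ab: "\<And>t. (s, t) \<in> \<Omega> \<Longrightarrow> X (p s + t *\<^sub>R e s) = a + t *\<^sub>R b"
    using assms by meson
  have "\<exists>c. x - y = c *\<^sub>R b" if "x \<in> X ` ruling p e \<Omega> s" "y \<in> X ` ruling p e \<Omega> s" for x y
  proof -
    from that obtain t t' where "(s, t) \<in> \<Omega>" "x = X (p s + t *\<^sub>R e s)"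
        "(s, t') \<in> \<Omega>" "y = X (p s + t' *\<^sub>R e s)"
      unfolding ruling_def by auto
    then have "x = a + t *\<^sub>R b" "y = a + t' *\<^sub>R b"
      using ab by auto
    then have "x - y = (t - t') *\<^sub>R b"
      by (simp add: algebra_simps)
    then show ?thesis ..
  qed
  then show "collinear (X ` ruling p e \<Omega> s)"
    unfolding collinear_def by blast
qed

lemma affine_imp_ruled_graph:
  assumes "affine_along_rulings p e \<Omega> f"
  shows "ruled (fst ` \<Omega>) (ruling p e \<Omega>) (graph f)"
proof (rule ruledI)
  fix s assume "s \<in> fst ` \<Omega>"
  then obtain a b where ab: "\<And>t. (s, t) \<in> \<Omega> \<Longrightarrow> f (p s + t *\<^sub>R e s) = a + b * t"
    using assms unfolding affine_along_rulings_def by meson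
  show "\<exists>a b. \<forall>t. (s, t) \<in> \<Omega> \<longrightarrow> graph f (p s + t *\<^sub>R e s) = a + t *\<^sub>R b"
    by (rule exI[of _ "vector [p s $ 1, p s $ 2, a]"], rule exI[of _ "vector [e s $ 1, e s $ 2, b]"])
      (simp add: ab graph_def vec_eq_iff forall_3 mult.commute)
qed

lemma affine_imp_ruled_difference:
  assumes "affine_along_rulings p e \<Omega> (\<lambda>q. f q - g q)"
  shows "ruled (fst ` \<Omega>) (ruling p e \<Omega>) (difference_surface f g)"
proof (rule ruledI)
  fix s assume "s \<in> fst ` \<Omega>"
  then obtain a b where ab: "\<And>t. (s, t) \<in> \<Omega> \<Longrightarrow> f (p s + t *\<^sub>R e s) - g (p s + t *\<^sub>R e s) = a + b * t"
    using assms unfolding affine_along_rulings_def by meson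
  show "\<exists>a b. \<forall>t. (s, t) \<in> \<Omega> \<longrightarrow> difference_surface f g (p s + t *\<^sub>R e s) = a + t *\<^sub>R b"
    by (rule exI[of _ "vector [- p s $ 2, p s $ 1, a]"], rule exI[of _ "vector [- e s $ 2, e s $ 1, b]"])
      (simp add: ab difference_surface_def vec_eq_iff forall_3 mult.commute)
qed

lemma affine_along_rulings_combine:
  assumes "affine_along_rulings p e \<Omega> f" "affine_along_rulings p e \<Omega> g"
  shows "affine_along_rulings p e \<Omega> (\<lambda>q. \<alpha> * f q + \<beta> * g q)"
  unfolding affine_along_rulings_def
proof
  fix s assume "s \<in> fst ` \<Omega>"
  then obtain a b a' b' where "\<And>t. (s, t) \<in> \<Omega> \<Longrightarrow> f (p s + t *\<^sub>R e s) = a + b * t"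
    "\<And>t. (s, t) \<in> \<Omega> \<Longrightarrow> g (p s + t *\<^sub>R e s) = a' + b' * t"
    using assms unfolding affine_along_rulings_def by meson
  then show "\<exists>a b. \<forall>t. (s, t) \<in> \<Omega> \<longrightarrow> \<alpha> * f (p s + t *\<^sub>R e s) + \<beta> * g (p s + t *\<^sub>R e s) = a + b * t"
    by (intro exI[of _ "\<alpha> * a + \<beta> * a'"] exI[of _ "\<alpha> * b + \<beta> * b'"]) (simp add: algebra_simps)
qed

lemma derivatives_along_ruling:
  assumes D: "second_order_on (ruled_domain p e \<Omega>) f G H" and st: "(s, t) \<in> \<Omega>"
  shows "((\<lambda>t. f (p s + t *\<^sub>R e s)) has_real_derivative G (p s + t *\<^sub>R e s) \<bullet> e s) (at t)"
    "((\<lambda>t. G (p s + t *\<^sub>R e s)) has_vector_derivative H (p s + t *\<^sub>R e s) *v e s) (at t)"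
proof -
  have q: "p s + t *\<^sub>R e s \<in> ruled_domain p e \<Omega>"
    using st by (force simp: ruled_domain_eq_image)
  have line: "((\<lambda>t. p s + t *\<^sub>R e s) has_derivative (\<lambda>k. k *\<^sub>R e s)) (at t)"
    by (auto intro!: derivative_eq_intros)
  show "((\<lambda>t. f (p s + t *\<^sub>R e s)) has_real_derivative G (p s + t *\<^sub>R e s) \<bullet> e s) (at t)"
    using has_derivative_compose[OF line second_order_onD(1)[OF D q]]
    by (simp add: has_field_derivative_def mult_commute_abs)
  show "((\<lambda>t. G (p s + t *\<^sub>R e s)) has_vector_derivative H (p s + t *\<^sub>R e s) *v e s) (at t)"
    using has_derivative_compose[OF line second_order_onD(2)[OF D q]]
    by (simp add: has_vector_derivative_def matrix_vector_mult_scaleR)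
qed

text \<open>The derivatives of an affine function of \<open>t\<close> along the ruling, expressed by the chain rule. The second
  conclusion says that the direction of a ruling is asymptotic.\<close>

lemma slope_along_ruling:
  assumes fam: "ruling_family p e \<Omega>" and D: "second_order_on (ruled_domain p e \<Omega>) f G H"
    and ab: "\<And>t. (s, t) \<in> \<Omega> \<Longrightarrow> f (p s + t *\<^sub>R e s) = a + b * t" and t: "(s, t) \<in> \<Omega>"
  shows "G (p s + t *\<^sub>R e s) \<bullet> e s = b" "e s \<bullet> (H (p s + t *\<^sub>R e s) *v e s) = 0"
proof -
  have op: "open {t. (s, t) \<in> \<Omega>}"
    using ruling_family_intervals(3)[OF fam] .
  have slope: "G (p s + t *\<^sub>R e s) \<bullet> e s = b" if t: "(s, t) \<in> \<Omega>" for t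
  proof -
    have "((\<lambda>t. a + b * t) has_real_derivative b) (at t)"
      by (auto intro!: derivative_eq_intros)
    then have "((\<lambda>t. f (p s + t *\<^sub>R e s)) has_real_derivative b) (at t)"
      using has_field_derivative_transform_within_open[OF _ op, of _ b t] ab t by simp
    then show ?thesis
      using DERIV_unique[OF derivatives_along_ruling(1)[OF D t]] by blast
  qed
  then show "G (p s + t *\<^sub>R e s) \<bullet> e s = b"
    using t .
  have "((\<lambda>t. G (p s + t *\<^sub>R e s) \<bullet> e s) has_derivative (\<lambda>k. (k *\<^sub>R (H (p s + t *\<^sub>R e s) *v e s)) \<bullet> e s)) (at t)"
    using derivatives_along_ruling(2)[OF D t] unfolding has_vector_derivative_def
    by (rule has_derivative_inner_left)
  moreover have "((\<lambda>t. G (p s + t *\<^sub>R e s) \<bullet> e s) has_derivative (\<lambda>k. 0)) (at t)"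
    using has_derivative_transform_within_open[OF has_derivative_const op, of t b] slope t by simp
  ultimately have "(\<lambda>k. (k *\<^sub>R (H (p s + t *\<^sub>R e s) *v e s)) \<bullet> e s) = (\<lambda>k. 0)"
    by (rule has_derivative_unique)
  from fun_cong[OF this, of 1] show "e s \<bullet> (H (p s + t *\<^sub>R e s) *v e s) = 0"
    by (simp add: inner_commute)
qed

lemma orthogonal_frame_zero:
  assumes "d \<noteq> 0" "d \<bullet> x = 0" "rot d \<bullet> x = 0"
  shows "x = 0"
proof -
  have "(d \<bullet> d) * x $ 1 = d $ 1 * (d \<bullet> x) - d $ 2 * (rot d \<bullet> x)"
    "(d \<bullet> d) * x $ 2 = d $ 2 * (d \<bullet> x) + d $ 1 * (rot d \<bullet> x)"
    by (simp_all add: inner_2 algebra_simps)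
  then have "(d \<bullet> d) * x $ 1 = 0" "(d \<bullet> d) * x $ 2 = 0"
    by (simp_all only: assms(2,3) mult_zero_right diff_zero add_0)
  moreover have "d \<bullet> d \<noteq> 0"
    using assms(1) by simp
  ultimately have "x $ 1 = 0" "x $ 2 = 0"
    by (metis mult_eq_0_iff)+
  then show ?thesis
    by (simp add: vec_eq_iff forall_2)
qed

text \<open>The derivative of the gradient along the ruling is the Hessian matrix applied to \<open>e\<close>. This vector is
  orthogonal to \<open>e\<close> because \<open>e\<close> is asymptotic, so it vanishes iff its component along \<open>rot e\<close>, the mixed
  entry, does.\<close>

lemma gradient_constant_iff:
  assumes fam: "ruling_family p e \<Omega>" "s \<in> fst ` \<Omega>"
    and D: "second_order_on (ruled_domain p e \<Omega>) f G H"
    and sym: "\<And>q h k. q \<in> ruled_domain p e \<Omega> \<Longrightarrow> h \<bullet> (H q *v k) = k \<bullet> (H q *v h)"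
    and f: "affine_along_rulings p e \<Omega> f"
  shows "(\<forall>q\<in>ruling p e \<Omega> s. \<forall>q'\<in>ruling p e \<Omega> s. G q = G q')
     \<longleftrightarrow> (\<forall>q\<in>ruling p e \<Omega> s. e s \<bullet> (H q *v rot (e s)) = 0)"
proof -
  let ?T = "{t. (s, t) \<in> \<Omega>}"
  note T = ruling_family_intervals(3,4)[OF fam(1), of s]
  have inD: "p s + t *\<^sub>R e s \<in> ruled_domain p e \<Omega>" if "(s, t) \<in> \<Omega>" for t
    using that by (force simp: ruled_domain_eq_image)
  obtain a b where ab: "\<And>t. (s, t) \<in> \<Omega> \<Longrightarrow> f (p s + t *\<^sub>R e s) = a + b * t"
    using f fam(2) unfolding affine_along_rulings_def by meson
  have rewr: "rot (e s) \<bullet> (H (p s + t *\<^sub>R e s) *v e s) = e s \<bullet> (H (p s + t *\<^sub>R e s) *v rot (e s))"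
    if "(s, t) \<in> \<Omega>" for t
    using sym[OF inD[OF that]] .
  have "(\<forall>t\<in>?T. \<forall>t'\<in>?T. G (p s + t *\<^sub>R e s) = G (p s + t' *\<^sub>R e s))
     \<longleftrightarrow> (\<forall>t\<in>?T. H (p s + t *\<^sub>R e s) *v e s = 0)"
  proof (intro iffI ballI)
    fix t assume const: "\<forall>t\<in>?T. \<forall>t'\<in>?T. G (p s + t *\<^sub>R e s) = G (p s + t' *\<^sub>R e s)" and t: "t \<in> ?T"
    have "((\<lambda>t. G (p s + t *\<^sub>R e s)) has_vector_derivative 0) (at t)"
    proof (rule has_vector_derivative_transform_within_open[OF has_vector_derivative_const T(1) t])
      show "G (p s + t *\<^sub>R e s) = G (p s + t' *\<^sub>R e s)" if "t' \<in> ?T" for t'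
        using const t that by blast
    qed
    then show "H (p s + t *\<^sub>R e s) *v e s = 0"
      using vector_derivative_unique_at[OF derivatives_along_ruling(2)[OF D]] t by blast
  next
    fix t t' assume zero: "\<forall>t\<in>?T. H (p s + t *\<^sub>R e s) *v e s = 0" and t: "t \<in> ?T" "t' \<in> ?T"
    have "((\<lambda>t. G (p s + t *\<^sub>R e s)) has_vector_derivative 0) (at t within ?T)" if "t \<in> ?T" for t
      using derivatives_along_ruling(2)[OF D, of s t] zero that
      by (simp add: has_vector_derivative_at_within)
    then obtain c where "\<And>t. t \<in> ?T \<Longrightarrow> G (p s + t *\<^sub>R e s) = c"
      using has_vector_derivative_zero_constant[OF T(2)] by blast
    then show "G (p s + t *\<^sub>R e s) = G (p s + t' *\<^sub>R e s)"
      using t by simp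
  qed
  also have "\<dots> \<longleftrightarrow> (\<forall>t\<in>?T. e s \<bullet> (H (p s + t *\<^sub>R e s) *v rot (e s)) = 0)"
  proof (intro ball_cong refl)
    fix t assume t: "t \<in> ?T"
    have "e s \<noteq> 0"
      using ruling_family_nonzero[OF fam] .
    then show "H (p s + t *\<^sub>R e s) *v e s = 0 \<longleftrightarrow> e s \<bullet> (H (p s + t *\<^sub>R e s) *v rot (e s)) = 0"
      using orthogonal_frame_zero[of "e s" "H (p s + t *\<^sub>R e s) *v e s"] rewr[of t] t
        slope_along_ruling(2)[OF fam(1) D ab, of t] by auto
  qed
  finally show ?thesis
    by (auto simp: ruling_def)
qed

section \<open>Torsal difference surfaces\<close>

text \<open>The point of space with height \<open>z\<close> over \<open>rot q\<close>. As a linear bijection of \<open>(q, z)\<close> it reduces statements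
  on the difference surface to statements on the graph of \<open>f - g\<close>.\<close>

definition turned_lift :: "real^2 \<Rightarrow> real \<Rightarrow> real^3" where
  "turned_lift q z = vector [- q $ 2, q $ 1, z]"

lemma turned_lift_simps [simp]:
  "turned_lift q z = turned_lift q' z' \<longleftrightarrow> q = q' \<and> z = z'"
  "turned_lift q z + turned_lift q' z' = turned_lift (q + q') (z + z')"
  "r *\<^sub>R turned_lift q z = turned_lift (r *\<^sub>R q) (r * z)"
  "top_view (turned_lift q z) = rot q"
  by (auto simp: turned_lift_def vec_eq_iff forall_2 forall_3 top_view_def)

lemma difference_surface_eq_lift: "difference_surface f g q = turned_lift q (f q - g q)"
  by (simp add: difference_surface_def turned_lift_def)

lemma bounded_linear_turned_lift: "bounded_linear (\<lambda>x. turned_lift (fst x) (snd x))"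
  by (rule linear_conv_bounded_linear[THEN iffD1], rule linearI) simp_all

lemma turned_lift_has_derivative:
  assumes "(q has_derivative q') (at x within S)" "(z has_derivative z') (at x within S)"
  shows "((\<lambda>x. turned_lift (q x) (z x)) has_derivative (\<lambda>h. turned_lift (q' h) (z' h))) (at x within S)"
  using bounded_linear.has_derivative[OF bounded_linear_turned_lift has_derivative_Pair[OF assms]] by simp

lemma tangent_plane_lift:
  assumes "((\<lambda>q. f q - g q) has_derivative (\<lambda>h. G \<bullet> h)) (at q)"
  shows "tangent_plane (difference_surface f g) q
     = range (\<lambda>x. turned_lift x (f q - g q + G \<bullet> (x - q)))"
proof -
  have "(difference_surface f g has_derivative (\<lambda>h. turned_lift h (G \<bullet> h))) (at q)"
    using turned_lift_has_derivative[OF has_derivative_ident assms]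
    by (simp add: difference_surface_eq_lift[abs_def])
  then have "tangent_plane (difference_surface f g) q
      = range (\<lambda>h. turned_lift (q + h) (f q - g q + G \<bullet> h))"
    by (simp add: tangent_plane_def frechet_derivative_at[symmetric] difference_surface_eq_lift)
  also have "\<dots> = (\<lambda>x. turned_lift x (f q - g q + G \<bullet> (x - q))) ` range (\<lambda>h. q + h)"
    unfolding image_image by simp
  also have "range (\<lambda>h. q + h) = UNIV"
    by (rule surj_plus)
  finally show ?thesis .
qed

lemma range_lift_eq_iff:
  "range (\<lambda>x. turned_lift x (\<phi> x)) = range (\<lambda>x. turned_lift x (\<psi> x)) \<longleftrightarrow> \<phi> = \<psi>"
proof
  assume eq: "range (\<lambda>x. turned_lift x (\<phi> x)) = range (\<lambda>x. turned_lift x (\<psi> x))"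
  show "\<phi> = \<psi>"
  proof
    fix x
    have "turned_lift x (\<phi> x) \<in> range (\<lambda>x. turned_lift x (\<psi> x))"
      using eq by blast
    then show "\<phi> x = \<psi> x"
      by auto
  qed
qed simp

text \<open>The tangent plane at \<open>q\<close> is the lift of the affine function with gradient \<open>G q\<close> that takes the value of
  \<open>f - g\<close> at \<open>q\<close>. For two points of one ruling, on which \<open>f - g\<close> is affine, these affine functions coincide
  as soon as their gradients do.\<close>

lemma torsal_difference_iff:
  assumes fam: "ruling_family p e \<Omega>"
    and D: "second_order_on (ruled_domain p e \<Omega>) (\<lambda>q. f q - g q) G H"
    and aff: "affine_along_rulings p e \<Omega> (\<lambda>q. f q - g q)"
  shows "torsal (fst ` \<Omega>) (ruling p e \<Omega>) (difference_surface f g)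
     \<longleftrightarrow> (\<forall>s\<in>fst ` \<Omega>. \<forall>q\<in>ruling p e \<Omega> s. \<forall>q'\<in>ruling p e \<Omega> s. G q = G q')"
proof -
  have "tangent_plane (difference_surface f g) q = tangent_plane (difference_surface f g) q' \<longleftrightarrow> G q = G q'"
    if s: "s \<in> fst ` \<Omega>" and q: "q \<in> ruling p e \<Omega> s" "q' \<in> ruling p e \<Omega> s" for s q q'
  proof -
    have "q \<in> ruled_domain p e \<Omega>" "q' \<in> ruled_domain p e \<Omega>"
      using s q by (auto simp: ruled_domain_def)
    note planes = tangent_plane_lift[OF second_order_onD(1)[OF D this(1)]]
      tangent_plane_lift[OF second_order_onD(1)[OF D this(2)]]
    obtain a b where ab: "\<And>t. (s, t) \<in> \<Omega> \<Longrightarrow> f (p s + t *\<^sub>R e s) - g (p s + t *\<^sub>R e s) = a + b * t"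
      using aff s unfolding affine_along_rulings_def by meson
    obtain t t' where t: "(s, t) \<in> \<Omega>" "q = p s + t *\<^sub>R e s" "(s, t') \<in> \<Omega>" "q' = p s + t' *\<^sub>R e s"
      using q by (auto simp: ruling_def)
    have slope: "G q' \<bullet> e s = b"
      using slope_along_ruling(1)[OF fam D ab t(3)] t(4) by simp
    have "f q - g q - (f q' - g q') = b * (t - t')"
      using ab t by (simp add: algebra_simps)
    also have "\<dots> = G q' \<bullet> (q - q')"
      using slope t by (simp add: algebra_simps)
    finally have height: "f q - g q = f q' - g q' + G q' \<bullet> (q - q')"
      by simp
    have "(\<lambda>x. f q - g q + G q \<bullet> (x - q)) = (\<lambda>x. f q' - g q' + G q' \<bullet> (x - q')) \<longleftrightarrow> G q = G q'"
    proof
      assume eq: "(\<lambda>x. f q - g q + G q \<bullet> (x - q)) = (\<lambda>x. f q' - g q' + G q' \<bullet> (x - q'))"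
      have "(G q - G q') \<bullet> x = 0" for x
        using fun_cong[OF eq, of "q + x"] height by (simp add: inner_simps)
      from this[of "G q - G q'"] show "G q = G q'"
        by simp
    next
      assume "G q = G q'"
      then show "(\<lambda>x. f q - g q + G q \<bullet> (x - q)) = (\<lambda>x. f q' - g q' + G q' \<bullet> (x - q'))"
        using height by (simp add: fun_eq_iff inner_simps)
    qed
    then show ?thesis
      unfolding planes range_lift_eq_iff .
  qed
  then show ?thesis
    unfolding torsal_def using affine_imp_ruled_difference[OF aff] by blast
qed

section \<open>Trivial isometries and planar difference surfaces\<close>

text \<open>A nonzero affine function changes its value when a point is moved in the direction of its gradient.\<close>

lemma affine_zero_on_open:
  fixes c :: "'a::real_inner"
  assumes "open D" "q\<^sub>0 \<in> D" and zero: "\<And>q. q \<in> D \<Longrightarrow> c \<bullet> q + d = 0"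
  shows "c = 0"
proof -
  obtain r where r: "r > 0" "ball q\<^sub>0 r \<subseteq> D"
    using assms(1,2) openE by blast
  define k where "k = r / (norm c + 1)"
  have pos: "norm c + 1 > 0"
    using norm_ge_zero[of c] by linarith
  have "k > 0" "k * norm c < r"
    using r(1) pos by (auto simp: k_def field_simps)
  then have "q\<^sub>0 + k *\<^sub>R c \<in> D"
    using r(2) by (auto simp: dist_norm)
  from zero[OF this] zero[OF assms(2)] have "k * (c \<bullet> c) = 0"
    unfolding inner_add_right inner_scaleR_right by linarith
  then show ?thesis
    using \<open>k > 0\<close> by simp
qed

text \<open>A plane containing the difference surface is not vertical, because the surface lies over an open set of
  the top view; so it is the graph of an affine function. Conversely such a graph is spanned by three of its points.\<close>

lemma coplanar_difference_iff:
  assumes D: "open D" "D \<noteq> {}"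
  shows "coplanar (difference_surface f g ` D) \<longleftrightarrow> (\<exists>c d. \<forall>q\<in>D. f q - g q = c \<bullet> q + d)"
proof
  assume "coplanar (difference_surface f g ` D)"
  then obtain u v w where uvw: "difference_surface f g ` D \<subseteq> affine hull {u, v, w}"
    by (auto simp: coplanar_def)
  have "card {u, v, w} \<le> 3"
    by (simp add: card_insert_if)
  then have "aff_dim (affine hull {u, v, w}) < DIM(real^3)"
    using aff_dim_le_card[of "{u, v, w}"] by simp
  then obtain n k where n: "n \<noteq> 0" "affine hull {u, v, w} \<subseteq> {x. n \<bullet> x = k}"
    by (rule aff_lowdim_subset_hyperplane)
  \<comment> \<open>The difference surface has top view \<open>rot q\<close>, and \<open>c \<bullet> q\<close> is the inner product of the horizontal part of \<open>n\<close> with \<open>rot q\<close>.\<close>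
  define c :: "real^2" where "c = vector [n $ 2, - n $ 1]"
  have plane: "c \<bullet> q + n $ 3 * (f q - g q) = k" if "q \<in> D" for q
  proof -
    have "n \<bullet> difference_surface f g q = k"
      using uvw n(2) that by blast
    then show ?thesis
      by (simp add: c_def inner_2 inner_vec_def sum_3 difference_surface_def algebra_simps)
  qed
  have "n $ 3 \<noteq> 0"
  proof
    assume n3: "n $ 3 = 0"
    obtain q\<^sub>0 where "q\<^sub>0 \<in> D"
      using D(2) by blast
    then have "c = 0"
      by (rule affine_zero_on_open[OF D(1), where d = "- k"]) (use plane n3 in force)
    then have "n $ 1 = 0" "n $ 2 = 0"
      by (simp_all add: c_def vec_eq_iff forall_2)
    then show False
      using n(1) n3 by (simp add: vec_eq_iff forall_3)
  qed
  have "f q - g q = (- (1 / n $ 3) *\<^sub>R c) \<bullet> q + k / n $ 3" if "q \<in> D" for q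
    using plane[OF that] \<open>n $ 3 \<noteq> 0\<close> by (simp add: field_simps)
  then show "\<exists>c d. \<forall>q\<in>D. f q - g q = c \<bullet> q + d"
    by blast
next
  assume "\<exists>c d. \<forall>q\<in>D. f q - g q = c \<bullet> q + d"
  then obtain c d where cd: "\<And>q. q \<in> D \<Longrightarrow> f q - g q = c \<bullet> q + d"
    by blast
  let ?u = "turned_lift 0 d" and ?v = "turned_lift (axis 1 1) (c $ 1 + d)"
    and ?w = "turned_lift (axis 2 1) (c $ 2 + d)"
  have "difference_surface f g q \<in> affine hull {?u, ?v, ?w}" if "q \<in> D" for q
  proof -
    have "difference_surface f g q = (1 - q $ 1 - q $ 2) *\<^sub>R ?u + q $ 1 *\<^sub>R ?v + q $ 2 *\<^sub>R ?w"
    proof -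
      have "q $ 1 *\<^sub>R axis 1 1 + q $ 2 *\<^sub>R axis 2 1 = q"
        by (simp add: vec_eq_iff forall_2 axis_def)
      then show ?thesis
        by (simp add: difference_surface_eq_lift cd[OF that] inner_2 algebra_simps)
    qed
    then show ?thesis
      unfolding affine_hull_3 by (smt (verit, ccfv_threshold) mem_Collect_eq)
  qed
  then show "coplanar (difference_surface f g ` D)"
    unfolding coplanar_def by blast
qed

text \<open>A congruence acts on the top view by itself, so the third column of its matrix is vertical. Since
  corresponding points have equal top views and these fill an open set, the upper left block is the
  identity, and determinant 1 leaves the height unscaled: the map adds an affine function of the top view to
  the height. Conversely, every such map is a congruence, and it preserves second derivatives.\<close>

lemma trivially_isometric_iff:
  assumes D: "open D" "D \<noteq> {}" and smooth: "Ck_on 2 f D" "Ck_on 2 g D"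
  shows "trivially_isometric D f g \<longleftrightarrow> (\<exists>c d. \<forall>q\<in>D. f q - g q = c \<bullet> q + d)"
proof
  assume "trivially_isometric D f g"
  then obtain A b and h :: "real^2 \<Rightarrow> real^2" where A: "det (A::real^3^3) = 1"
    and h: "\<And>x. top_view (A *v x + b) = h (top_view x)"
    and map: "\<And>q. q \<in> D \<Longrightarrow> A *v graph f q + b = graph g q"
    unfolding trivially_isometric_def isotropic_congruence_def by metis
  \<comment> \<open>Points on one vertical line have images on one vertical line.\<close>
  have "top_view (axis 3 1) = top_view 0"
    by (simp add: top_view_def axis_def vec_eq_iff forall_2)
  then have vertical: "top_view (A *v axis 3 1 + b) = top_view (A *v 0 + b)"
    using h by metis
  have A3: "A $ 1 $ 3 = 0" "A $ 2 $ 3 = 0"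
    using vertical
    by (simp_all add: top_view_def vec_eq_iff forall_2 matrix_vector_mult_basis column_def)
  obtain q\<^sub>0 where q0: "q\<^sub>0 \<in> D"
    using D(2) by blast
  define a\<^sub>1 a\<^sub>2 :: "real^2" where "a\<^sub>1 = vector [A $ 1 $ 1 - 1, A $ 1 $ 2]"
    and "a\<^sub>2 = vector [A $ 2 $ 1, A $ 2 $ 2 - 1]"
  have comp: "a\<^sub>1 \<bullet> q + b $ 1 = 0" "a\<^sub>2 \<bullet> q + b $ 2 = 0"
    "A $ 3 $ 1 * q $ 1 + A $ 3 $ 2 * q $ 2 + A $ 3 $ 3 * f q + b $ 3 = g q" if "q \<in> D" for q
    using map[OF that] A3
    by (simp_all add: a\<^sub>1_def a\<^sub>2_def inner_2 graph_def vec_eq_iff forall_3 matrix_vector_mult_def sum_3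
        algebra_simps)
  have "a\<^sub>1 = 0" "a\<^sub>2 = 0"
    using affine_zero_on_open[OF D(1) q0 comp(1)] affine_zero_on_open[OF D(1) q0 comp(2)]
    by blast+
  then have "A $ 1 $ 1 = 1" "A $ 1 $ 2 = 0" "A $ 2 $ 1 = 0" "A $ 2 $ 2 = 1"
    by (simp_all add: a\<^sub>1_def a\<^sub>2_def vec_eq_iff forall_2)
  then have "A $ 3 $ 3 = 1"
    using A A3 by (simp add: det_3)
  then have "f q - g q = (- vector [A $ 3 $ 1, A $ 3 $ 2]) \<bullet> q + - b $ 3" if "q \<in> D" for q
    using comp(3)[OF that] by (simp add: inner_2)
  then show "\<exists>c d. \<forall>q\<in>D. f q - g q = c \<bullet> q + d"
    by blast
next
  assume "\<exists>c d. \<forall>q\<in>D. f q - g q = c \<bullet> q + d"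
  then obtain c d where cd: "\<And>q. q \<in> D \<Longrightarrow> f q - g q = c \<bullet> q + d"
    by blast
  define A :: "real^3^3" where "A = vector [vector [1, 0, 0], vector [0, 1, 0], vector [- c $ 1, - c $ 2, 1]]"
  define b :: "real^3" where "b = vector [0, 0, - d]"
  have A: "A *v x + b = vector [x $ 1, x $ 2, x $ 3 - c $ 1 * x $ 1 - c $ 2 * x $ 2 - d]" for x
    by (simp add: A_def b_def vec_eq_iff forall_3 matrix_vector_mult_def sum_3)
  have "isotropic_congruence (\<lambda>x. A *v x + b)"
    unfolding isotropic_congruence_def
  proof (intro conjI exI allI)
    show "det A = 1"
      by (simp add: A_def det_3)
    show "top_view (A *v x + b) = id (top_view x)" for x
      by (simp add: A top_view_def)
  qed auto
  moreover have "A *v graph f q + b = graph g q" if "q \<in> D" for q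
    unfolding A using cd[OF that] by (simp add: graph_def inner_2 vec_eq_iff forall_3 algebra_simps)
  moreover have "isotropically_isometric D f g"
    unfolding isotropically_isometric_def
  proof
    fix q assume q: "q \<in> D"
    have "second_order_on D (\<lambda>q. f q - g q) (\<lambda>q. c) (\<lambda>q. 0)"
      using second_order_on_cong[OF D(1) cd second_order_on_affine] .
    then have "hessian (\<lambda>q. f q - g q) q = 0"
      using second_order_on_hessian[OF D(1) _ q] by blast
    moreover have "hessian (\<lambda>q. f q - g q) q = hessian f q - hessian g q"
      using second_order_on_hessian[OF D(1) Ck_on_2_diff_second_order[OF smooth] q] .
    ultimately show "graph_curvature f q = graph_curvature g q"
      by (simp add: Ck_on_2_graph_curvature[OF D(1) q smooth(1)] Ck_on_2_graph_curvature[OF D(1) q smooth(2)])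
  qed
  ultimately show "trivially_isometric D f g"
    unfolding trivially_isometric_def by blast
qed

section \<open>Tangent surfaces, cones and cylinders\<close>

text \<open>Here \<open>N s\<close> is the constant value of the gradient along the ruling \<open>s\<close> and \<open>k s\<close> is the height at the origin
  of the corresponding tangent plane. Both are differentiable in \<open>s\<close> because near any \<open>s\<close> they can be
  evaluated along a curve \<open>p s + t e s\<close> with fixed \<open>t\<close>. Differentiating \<open>g x = N s \<bullet> x + k s\<close> along this
  curve, the terms with the velocity of \<open>x\<close> cancel since \<open>N s\<close> is the gradient of \<open>g\<close>, and
  \<open>N' s \<bullet> x + k' s = 0\<close> is left. As this holds for two values of \<open>t\<close>, the part in the direction \<open>e s\<close> vanishes
  separately.\<close>

lemma constant_gradient_envelope:
  assumes fam: "ruling_family p e \<Omega>"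
    and D: "second_order_on (ruled_domain p e \<Omega>) g G H"
    and aff: "affine_along_rulings p e \<Omega> g"
    and const: "\<forall>s\<in>fst ` \<Omega>. \<forall>q\<in>ruling p e \<Omega> s. \<forall>q'\<in>ruling p e \<Omega> s. G q = G q'"
  obtains N N' k k' where
    "\<forall>s\<in>fst ` \<Omega>. (N has_vector_derivative N' s) (at s)"
    "\<forall>s\<in>fst ` \<Omega>. (k has_real_derivative k' s) (at s)"
    "\<forall>s\<in>fst ` \<Omega>. N' s \<bullet> e s = 0"
    "\<forall>s\<in>fst ` \<Omega>. N' s \<bullet> p s + k' s = 0"
    "\<forall>s\<in>fst ` \<Omega>. \<forall>q\<in>ruling p e \<Omega> s. g q = N s \<bullet> q + k s"
proof -
  define \<tau> where "\<tau> s = (SOME t. (s, t) \<in> \<Omega>)" for s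
  have \<tau>: "(s, \<tau> s) \<in> \<Omega>" if "s \<in> fst ` \<Omega>" for s
    using that unfolding \<tau>_def by (auto intro: someI)
  define N where "N s = G (p s + \<tau> s *\<^sub>R e s)" for s
  define k where "k s = g (p s + \<tau> s *\<^sub>R e s) - N s \<bullet> (p s + \<tau> s *\<^sub>R e s)" for s
  have N: "N s = G (p s + t *\<^sub>R e s)" if "(s, t) \<in> \<Omega>" for s t
  proof -
    have s: "s \<in> fst ` \<Omega>"
      using that by force
    show ?thesis
      unfolding N_def by (rule const[rule_format, OF s]) (use that \<tau>[OF s] in \<open>auto simp: ruling_def\<close>)
  qed
  have k: "k s = g (p s + t *\<^sub>R e s) - N s \<bullet> (p s + t *\<^sub>R e s)" if st: "(s, t) \<in> \<Omega>" for s t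
  proof -
    have s: "s \<in> fst ` \<Omega>"
      using st by force
    then obtain a b where ab: "\<And>t. (s, t) \<in> \<Omega> \<Longrightarrow> g (p s + t *\<^sub>R e s) = a + b * t"
      using aff unfolding affine_along_rulings_def by meson
    have "N s \<bullet> e s = b"
      using slope_along_ruling(1)[OF fam D ab st] N[OF st] by simp
    then show ?thesis
      using ab[OF st] ab[OF \<tau>[OF s]] by (simp add: k_def inner_simps algebra_simps)
  qed
  have envelope: "N differentiable (at s) \<and>
      (k has_real_derivative - (vector_derivative N (at s) \<bullet> (p s + t *\<^sub>R e s))) (at s)"
    if st: "(s, t) \<in> \<Omega>" for s t
  proof -
    have s: "s \<in> fst ` \<Omega>" and q: "p s + t *\<^sub>R e s \<in> ruled_domain p e \<Omega>"
      using st by (force simp: ruled_domain_eq_image)+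
    have "open \<Omega>"
      using fam by (simp add: ruling_family_def)
    \<comment> \<open>For fixed \<open>t\<close> the curve \<open>p s + t e s\<close> meets the region for \<open>s\<close> near the given value, which suffices to differentiate there.\<close>
    then have op: "open {s. (s, t) \<in> \<Omega>}"
      using open_vimage[of \<Omega> "\<lambda>s. (s, t)"] by (simp add: vimage_def continuous_intros)
    let ?x = "\<lambda>s. p s + t *\<^sub>R e s"
    let ?x' = "vector_derivative p (at s) + t *\<^sub>R vector_derivative e (at s)"
    have x: "(?x has_derivative (\<lambda>h. h *\<^sub>R ?x')) (at s)"
      using ruling_family_differentiable[OF fam s] unfolding has_vector_derivative_def
      by (auto intro!: derivative_eq_intros simp: scaleR_add_right mult.commute)
    have "((\<lambda>s. G (?x s)) has_derivative (\<lambda>h. H (?x s) *v (h *\<^sub>R ?x'))) (at s)"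
      using has_derivative_compose[OF x second_order_onD(2)[OF D q]] .
    then have "(N has_derivative (\<lambda>h. H (?x s) *v (h *\<^sub>R ?x'))) (at s)"
      by (rule has_derivative_transform_within_open[OF _ op]) (use st N in auto)
    then have diff: "N differentiable (at s)"
      by (rule differentiableI)
    then have N': "(N has_derivative (\<lambda>h. h *\<^sub>R vector_derivative N (at s))) (at s)"
      by (simp add: vector_derivative_works has_vector_derivative_def)
    have "((\<lambda>s. g (?x s)) has_derivative (\<lambda>h. G (?x s) \<bullet> (h *\<^sub>R ?x'))) (at s)"
      using has_derivative_compose[OF x second_order_onD(1)[OF D q]] .
    from has_derivative_diff[OF this has_derivative_inner[OF N' x]]
    have "((\<lambda>s. g (?x s) - N s \<bullet> ?x s) has_derivative
        (\<lambda>h. - (vector_derivative N (at s) \<bullet> ?x s) * h)) (at s)"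
      using N[OF st] by (simp add: mult.commute)
    then have "(k has_derivative (\<lambda>h. - (vector_derivative N (at s) \<bullet> ?x s) * h)) (at s)"
      by (rule has_derivative_transform_within_open[OF _ op]) (use st k in auto)
    then show ?thesis
      using diff unfolding has_field_derivative_def by blast
  qed
  define N' where "N' s = vector_derivative N (at s)" for s
  define k' where "k' s = - (N' s \<bullet> (p s + \<tau> s *\<^sub>R e s))" for s
  have deriv: "(N has_vector_derivative N' s) (at s)" "(k has_real_derivative k' s) (at s)"
    if "s \<in> fst ` \<Omega>" for s
    using envelope[OF \<tau>[OF that]] by (simp_all add: N'_def k'_def vector_derivative_works)
  have k'_eq: "k' s = - (N' s \<bullet> (p s + t *\<^sub>R e s))" if "(s, t) \<in> \<Omega>" for s t
  proof (rule DERIV_unique)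
    show "(k has_real_derivative k' s) (at s)"
      using that by (intro deriv(2)) force
    show "(k has_real_derivative - (N' s \<bullet> (p s + t *\<^sub>R e s))) (at s)"
      using envelope[OF that] unfolding N'_def by blast
  qed
  have orth: "N' s \<bullet> e s = 0" if s: "s \<in> fst ` \<Omega>" for s
  proof -
    obtain t where t: "(s, t) \<in> \<Omega>" "t \<noteq> \<tau> s"
      using ruling_family_two_points[OF fam \<tau>[OF s]] .
    have "(t - \<tau> s) * (N' s \<bullet> e s) = 0"
      using k'_eq[OF t(1)] k'_eq[OF \<tau>[OF s]] by (simp add: inner_simps algebra_simps)
    then show ?thesis
      using t(2) by simp
  qed
  show thesis
  proof (rule that; intro ballI)
    show "(N has_vector_derivative N' s) (at s)" "(k has_real_derivative k' s) (at s)" "N' s \<bullet> e s = 0"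
      "N' s \<bullet> p s + k' s = 0" if "s \<in> fst ` \<Omega>" for s
      using deriv[OF that] orth[OF that] by (simp_all add: k'_def inner_simps)
    show "g q = N s \<bullet> q + k s" if "s \<in> fst ` \<Omega>" and q: "q \<in> ruling p e \<Omega> s" for s q
    proof -
      obtain t where t: "(s, t) \<in> \<Omega>" "q = p s + t *\<^sub>R e s"
        using q by (auto simp: ruling_def)
      show ?thesis
        using k[OF t(1)] t(2) by simp
    qed
  qed
qed

text \<open>The definition speaks of Frechet derivatives applied to the basis vector \<open>1\<close>; for curves this is the
  familiar condition on the velocity and the acceleration.\<close>

lemma Ck_on_2_curve_iff:
  fixes c :: "real \<Rightarrow> 'a::real_normed_vector"
  assumes I: "open I"
  shows "Ck_on 2 c I \<longleftrightarrow> (\<exists>c' c''. (\<forall>s\<in>I. (c has_vector_derivative c' s) (at s))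
     \<and> (\<forall>s\<in>I. (c' has_vector_derivative c'' s) (at s)) \<and> continuous_on I c'')"
proof -
  have frechet: "frechet_derivative f (at s) 1 = f'" if "(f has_vector_derivative f') (at s)"
    for f :: "real \<Rightarrow> 'a" and f' s
    using frechet_derivative_at[OF that[unfolded has_vector_derivative_def], symmetric] by simp
  have unfolded: "Ck_on 2 c I \<longleftrightarrow> (\<forall>s\<in>I. c differentiable (at s)) \<and>
      (\<forall>s\<in>I. (\<lambda>x. frechet_derivative c (at x) 1) differentiable (at s)) \<and>
      continuous_on I (\<lambda>x. frechet_derivative (\<lambda>x. frechet_derivative c (at x) 1) (at x) 1)"
    by (auto simp: numeral_2_eq_2)
  show ?thesis
  proof
    assume "Ck_on 2 c I"
    moreover have "(f has_vector_derivative frechet_derivative f (at s) 1) (at s)" if "f differentiable (at s)"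
      for f :: "real \<Rightarrow> 'a" and s
      using that frechet[of f "vector_derivative f (at s)" s] by (simp add: vector_derivative_works)
    ultimately show "\<exists>c' c''. (\<forall>s\<in>I. (c has_vector_derivative c' s) (at s))
        \<and> (\<forall>s\<in>I. (c' has_vector_derivative c'' s) (at s)) \<and> continuous_on I c''"
      unfolding unfolded by (intro exI conjI ballI) auto
  next
    assume "\<exists>c' c''. (\<forall>s\<in>I. (c has_vector_derivative c' s) (at s))
        \<and> (\<forall>s\<in>I. (c' has_vector_derivative c'' s) (at s)) \<and> continuous_on I c''"
    then obtain c' c'' where c: "\<And>s. s \<in> I \<Longrightarrow> (c has_vector_derivative c' s) (at s)"
      "\<And>s. s \<in> I \<Longrightarrow> (c' has_vector_derivative c'' s) (at s)" "continuous_on I c''"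
      by blast
    have d: "((\<lambda>x. frechet_derivative c (at x) 1) has_vector_derivative c'' s) (at s)" if "s \<in> I" for s
      by (rule has_vector_derivative_transform_within_open[OF c(2)[OF that] I that])
        (simp add: frechet[OF c(1)])
    have "continuous_on I (\<lambda>x. frechet_derivative (\<lambda>x. frechet_derivative c (at x) 1) (at x) 1)"
      by (rule continuous_on_eq[OF c(3)]) (simp add: frechet[OF d])
    then show "Ck_on 2 c I"
      unfolding unfolded using c(1) d differentiableI_vector by blast
  qed
qed

lemma affine_line: "affine (range (\<lambda>r. a + r *\<^sub>R b))"
  unfolding affine_def
proof (intro ballI allI impI)
  fix x y :: 'a and u v :: real
  assume "x \<in> range (\<lambda>r. a + r *\<^sub>R b)" "y \<in> range (\<lambda>r. a + r *\<^sub>R b)" and uv: "u + v = 1"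
  then obtain r r' where "x = a + r *\<^sub>R b" "y = a + r' *\<^sub>R b"
    by auto
  then have "u *\<^sub>R x + v *\<^sub>R y = (u + v) *\<^sub>R a + (u * r + v * r') *\<^sub>R b"
    by (simp add: algebra_simps)
  then show "u *\<^sub>R x + v *\<^sub>R y \<in> range (\<lambda>r. a + r *\<^sub>R b)"
    using uv by (intro range_eqI[where x = "u * r + v * r'"]) simp
qed

text \<open>Affine maps carry affine hulls to affine hulls, in particular a common point of the lines that carry the
  rulings to a point of the lines that carry the lifted rulings.\<close>

lemma affine_hull_lift:
  assumes "z \<in> affine hull S"
  shows "turned_lift z (n \<bullet> z + k) \<in> affine hull ((\<lambda>q. turned_lift q (n \<bullet> q + k)) ` S)"
proof -
  have lin: "bounded_linear (\<lambda>q. turned_lift q (n \<bullet> q))"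
    by (rule linear_conv_bounded_linear[THEN iffD1], rule linearI) (simp_all add: inner_simps)
  have image: "(\<lambda>q. turned_lift q (n \<bullet> q + k)) ` T = (+) (turned_lift 0 k) ` (\<lambda>q. turned_lift q (n \<bullet> q)) ` T" for T
    by (simp add: image_image add.commute)
  have "turned_lift z (n \<bullet> z + k) \<in> (\<lambda>q. turned_lift q (n \<bullet> q + k)) ` (affine hull S)"
    using assms by (rule imageI)
  then show ?thesis
    unfolding image affine_hull_translation affine_hull_linear_image[OF lin] .
qed

text \<open>The envelope equations say that at a fixed point of the line carrying the ruling, or in its direction, the
  height given by the tangent plane \<open>N s \<bullet> x + k s\<close> does not change to first order. A fixed common point or a
  fixed common direction thus keeps its height for all \<open>s\<close>. If the rulings are tangent to a curve \<open>c\<close>, then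
  the lift \<open>N s \<bullet> c s + k s\<close> has derivative \<open>N \<bullet> c'\<close> and hence is tangent to the lifted ruling; its second
  derivative is \<open>N \<bullet> c''\<close> because \<open>c'\<close> has the direction of the ruling. So two derivatives of \<open>c\<close> and
  continuity of \<open>N\<close> give a twice continuously differentiable space curve.\<close>

lemma envelope_types:
  assumes fam: "ruling_family p e \<Omega>"
    and normal: "\<forall>s\<in>fst ` \<Omega>. (N has_vector_derivative N' s) (at s)"
    and offset: "\<forall>s\<in>fst ` \<Omega>. (k has_real_derivative k' s) (at s)"
    and direction: "\<forall>s\<in>fst ` \<Omega>. N' s \<bullet> e s = 0"
    and base: "\<forall>s\<in>fst ` \<Omega>. N' s \<bullet> p s + k' s = 0"
    and lift: "\<forall>s\<in>fst ` \<Omega>. \<forall>q\<in>ruling p e \<Omega> s. V q = turned_lift q (N s \<bullet> q + k s)"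
  shows "type_I (fst ` \<Omega>) (ruling p e \<Omega>) \<Longrightarrow> tangent_surface (fst ` \<Omega>) (ruling p e \<Omega>) V"
    and "type_II (fst ` \<Omega>) (ruling p e \<Omega>) \<Longrightarrow> concurrent_lines (fst ` \<Omega>) (\<lambda>s. V ` ruling p e \<Omega> s)"
    and "type_III (fst ` \<Omega>) (ruling p e \<Omega>) \<Longrightarrow> nonisotropic_cylinder (fst ` \<Omega>) (ruling p e \<Omega>) V"
proof -
  let ?I = "fst ` \<Omega>" and ?L = "ruling p e \<Omega>"
  note I = ruling_family_intervals(1,2)[OF fam]
  note N = bspec[OF normal] and k = bspec[OF offset] and dir = bspec[OF direction] and pt = bspec[OF base]
  have image: "V ` ?L s = (\<lambda>q. turned_lift q (N s \<bullet> q + k s)) ` ?L s" if "s \<in> ?I" for s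
    using bspec[OF lift that] by (intro image_cong) auto
  have stationary: "N' s \<bullet> (p s + t *\<^sub>R e s) + k' s = 0" if "s \<in> ?I" for s t
    using dir[OF that] pt[OF that] by (simp add: inner_simps)
  show "tangent_surface ?I ?L V" if "type_I ?I ?L"
  proof -
    obtain c where c: "Ck_on 2 c ?I" "\<And>s. s \<in> ?I \<Longrightarrow> vector_derivative c (at s) \<noteq> 0"
      "\<And>s. s \<in> ?I \<Longrightarrow> ?L s \<subseteq> tangent_line c s"
      using \<open>type_I ?I ?L\<close> unfolding type_I_def tangents_of_curve_def by blast
    obtain c' c'' where c': "\<And>s. s \<in> ?I \<Longrightarrow> (c has_vector_derivative c' s) (at s)"
      "\<And>s. s \<in> ?I \<Longrightarrow> (c' has_vector_derivative c'' s) (at s)" "continuous_on ?I c''"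
      using c(1) unfolding Ck_on_2_curve_iff[OF I(1)] by blast
    have vd: "vector_derivative c (at s) = c' s" if "s \<in> ?I" for s
      using vector_derivative_at[OF c'(1)[OF that]] .
    \<comment> \<open>The point above the point of contact of \<open>c\<close> with the line of the ruling, on the lifted line.\<close>
    define C where "C s = turned_lift (c s) (N s \<bullet> c s + k s)" for s
    have along: "N' s \<bullet> c s + k' s = 0" "N' s \<bullet> c' s = 0" if s: "s \<in> ?I" for s
    proof -
      obtain \<kappa> t where t: "c' s = \<kappa> *\<^sub>R e s" "c s = p s + t *\<^sub>R e s"
        using line_containing_ruling[OF fam s c(3)[OF s, unfolded tangent_line_def vd[OF s]]] .
      show "N' s \<bullet> c s + k' s = 0" "N' s \<bullet> c' s = 0"
        using stationary[OF s, of t] dir[OF s] t by simp_all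
    qed
    have C': "(C has_vector_derivative turned_lift (c' s) (N s \<bullet> c' s)) (at s)" if s: "s \<in> ?I" for s
    proof -
      have "((\<lambda>s. N s \<bullet> c s + k s) has_derivative
          (\<lambda>h. N s \<bullet> (h *\<^sub>R c' s) + (h *\<^sub>R N' s) \<bullet> c s + k' s * h)) (at s)"
        using N[OF s] k[OF s] c'(1)[OF s] unfolding has_vector_derivative_def has_field_derivative_def
        by (intro has_derivative_add has_derivative_inner)
      moreover have "N s \<bullet> (h *\<^sub>R c' s) + (h *\<^sub>R N' s) \<bullet> c s + k' s * h
          = h * (N s \<bullet> c' s) + h * (N' s \<bullet> c s + k' s)" for h
        by (simp add: algebra_simps)
      ultimately have "((\<lambda>s. N s \<bullet> c s + k s) has_derivative (\<lambda>h. h * (N s \<bullet> c' s))) (at s)"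
        by (simp only: along(1)[OF s] mult_zero_right add_0_right)
      with c'(1)[OF s] show ?thesis
        unfolding C_def[abs_def] has_vector_derivative_def turned_lift_simps
        by (intro turned_lift_has_derivative)
    qed
    have C'': "((\<lambda>s. turned_lift (c' s) (N s \<bullet> c' s)) has_vector_derivative
        turned_lift (c'' s) (N s \<bullet> c'' s)) (at s)" if s: "s \<in> ?I" for s
    proof -
      have "((\<lambda>s. N s \<bullet> c' s) has_derivative (\<lambda>h. N s \<bullet> (h *\<^sub>R c'' s) + (h *\<^sub>R N' s) \<bullet> c' s)) (at s)"
        using N[OF s] c'(2)[OF s] unfolding has_vector_derivative_def
        by (intro has_derivative_inner)
      then have "((\<lambda>s. N s \<bullet> c' s) has_derivative (\<lambda>h. h * (N s \<bullet> c'' s))) (at s)"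
        by (simp add: along(2)[OF s])
      with c'(2)[OF s] show ?thesis
        unfolding has_vector_derivative_def turned_lift_simps
        by (intro turned_lift_has_derivative)
    qed
    have "continuous_on ?I N"
      by (rule continuous_at_imp_continuous_on, rule ballI, rule has_vector_derivative_continuous, erule N)
    then have "continuous_on ?I (\<lambda>s. (c'' s, N s \<bullet> c'' s))"
      by (intro continuous_intros c'(3))
    from bounded_linear.continuous_on[OF bounded_linear_turned_lift this]
    have "continuous_on ?I (\<lambda>s. turned_lift (c'' s) (N s \<bullet> c'' s))"
      by simp
    with C' C'' have "Ck_on 2 C ?I"
      unfolding Ck_on_2_curve_iff[OF I(1)] by (intro exI conjI ballI)
    moreover have "vector_derivative C (at s) \<noteq> 0 \<and> V ` ?L s \<subseteq> tangent_line C s" if s: "s \<in> ?I" for s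
    proof -
      have C's: "vector_derivative C (at s) = turned_lift (c' s) (N s \<bullet> c' s)"
        using vector_derivative_at[OF C'[OF s]] .
      have "turned_lift (0::real^2) 0 = 0"
        by (simp add: turned_lift_def vec_eq_iff forall_3)
      then have "vector_derivative C (at s) \<noteq> 0"
        using c(2)[OF s] vd[OF s] unfolding C's by (metis turned_lift_simps(1))
      moreover have "turned_lift q (N s \<bullet> q + k s) \<in> tangent_line C s" if q: "q \<in> ?L s" for q
      proof -
        obtain r where "q = c s + r *\<^sub>R c' s"
          using c(3)[OF s] q unfolding tangent_line_def vd[OF s] by blast
        then have "turned_lift q (N s \<bullet> q + k s) = C s + r *\<^sub>R vector_derivative C (at s)"
          by (simp add: C's C_def inner_simps)
        then show ?thesis
          by (auto simp: tangent_line_def)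
      qed
      ultimately show ?thesis
        unfolding image[OF s] by blast
    qed
    ultimately show ?thesis
      unfolding tangent_surface_def tangents_of_curve_def by blast
  qed
  show "concurrent_lines ?I (\<lambda>s. V ` ?L s)" if "type_II ?I ?L"
  proof -
    obtain z where z: "\<And>s. s \<in> ?I \<Longrightarrow> z \<in> affine hull (?L s)"
      using \<open>type_II ?I ?L\<close> unfolding type_II_def concurrent_lines_def by blast
    have zero: "N' s \<bullet> z + k' s = 0" if s: "s \<in> ?I" for s
    proof -
      have "affine hull (?L s) \<subseteq> range (\<lambda>r. p s + r *\<^sub>R e s)"
        by (rule hull_minimal) (auto simp: ruling_def affine_line)
      then obtain r where "z = p s + r *\<^sub>R e s"
        using z[OF s] by blast
      then show ?thesis
        using stationary[OF s] by simp
    qed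
    have "((\<lambda>s. N s \<bullet> z + k s) has_real_derivative 0) (at s within ?I)" if s: "s \<in> ?I" for s
    proof -
      have "((\<lambda>s. N s \<bullet> z + k s) has_derivative (\<lambda>h. (h *\<^sub>R N' s) \<bullet> z + k' s * h)) (at s)"
        using N[OF s] k[OF s] unfolding has_vector_derivative_def has_field_derivative_def
        by (intro has_derivative_add has_derivative_inner_left)
      moreover have "(h *\<^sub>R N' s) \<bullet> z + k' s * h = 0 * h" for h
        using zero[OF s] by (simp add: distrib_left[symmetric] mult.commute)
      ultimately show ?thesis
        by (simp only: has_field_derivative_def has_derivative_at_withinI)
    qed
    then obtain \<zeta> where \<zeta>: "\<And>s. s \<in> ?I \<Longrightarrow> N s \<bullet> z + k s = \<zeta>"
      using has_field_derivative_zero_constant[OF I(2), of "\<lambda>s. N s \<bullet> z + k s"] by blast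
    have "turned_lift z \<zeta> \<in> affine hull (V ` ?L s)" if "s \<in> ?I" for s
      using affine_hull_lift[OF z[OF that], of "N s" "k s"] unfolding image[OF that] \<zeta>[OF that] .
    then show ?thesis
      unfolding concurrent_lines_def by blast
  qed
  show "nonisotropic_cylinder ?I ?L V" if "type_III ?I ?L"
  proof -
    obtain w where w: "w \<noteq> 0" "\<And>s. s \<in> ?I \<Longrightarrow> \<exists>z. ?L s \<subseteq> range (\<lambda>r. z + r *\<^sub>R w)"
      using \<open>type_III ?I ?L\<close> unfolding type_III_def parallel_to_def by blast
    have "((\<lambda>s. N s \<bullet> w) has_real_derivative 0) (at s within ?I)" if s: "s \<in> ?I" for s
    proof -
      obtain z where "?L s \<subseteq> range (\<lambda>r. z + r *\<^sub>R w)"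
        using w(2)[OF s] ..
      then obtain \<kappa> t where "w = \<kappa> *\<^sub>R e s" "z = p s + t *\<^sub>R e s"
        by (rule line_containing_ruling[OF fam s])
      then have "(h *\<^sub>R N' s) \<bullet> w = 0 * h" for h
        using dir[OF s] by simp
      moreover have "((\<lambda>s. N s \<bullet> w) has_derivative (\<lambda>h. (h *\<^sub>R N' s) \<bullet> w)) (at s)"
        using N[OF s] unfolding has_vector_derivative_def by (rule has_derivative_inner_left)
      ultimately show ?thesis
        by (simp only: has_field_derivative_def has_derivative_at_withinI)
    qed
    then obtain \<omega> where \<omega>: "\<And>s. s \<in> ?I \<Longrightarrow> N s \<bullet> w = \<omega>"
      using has_field_derivative_zero_constant[OF I(2), of "\<lambda>s. N s \<bullet> w"] by blast
    have "\<exists>z. V ` ?L s \<subseteq> range (\<lambda>r. z + r *\<^sub>R turned_lift w \<omega>)" if s: "s \<in> ?I" for s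
    proof -
      obtain z where "?L s \<subseteq> range (\<lambda>r. z + r *\<^sub>R w)"
        using w(2)[OF s] ..
      moreover have "turned_lift (z + r *\<^sub>R w) (N s \<bullet> (z + r *\<^sub>R w) + k s)
          = turned_lift z (N s \<bullet> z + k s) + r *\<^sub>R turned_lift w \<omega>" for r
        using \<omega>[OF s] by (simp add: inner_simps)
      ultimately have "V ` ?L s \<subseteq> range (\<lambda>r. turned_lift z (N s \<bullet> z + k s) + r *\<^sub>R turned_lift w \<omega>)"
        unfolding image[OF s] by blast
      then show ?thesis ..
    qed
    moreover have "top_view (turned_lift w \<omega>) \<noteq> 0"
      using w(1) by (simp add: vec_eq_iff forall_2 conj_commute)
    moreover from this have "turned_lift w \<omega> \<noteq> 0"
      by (auto simp: top_view_def vec_eq_iff forall_2)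
    ultimately show ?thesis
      unfolding nonisotropic_cylinder_def parallel_to_def by blast
  qed
qed

section \<open>The correspondence\<close>

theorem proposition38:
  fixes p e :: "real \<Rightarrow> real^2" and \<Omega> :: "(real \<times> real) set"
    and f1 f2 :: "real^2 \<Rightarrow> real"
  defines "I \<equiv> fst ` \<Omega>" and "L \<equiv> ruling p e \<Omega>" and "D \<equiv> ruled_domain p e \<Omega>"
    and "V \<equiv> difference_surface f1 f2"
  assumes family: "ruling_family p e \<Omega>"
    and smooth: "Ck_on 2 f1 D" "Ck_on 2 f2 D"
    and ruled: "ruled I L (graph f1)" "ruled I L (graph f2)"
  shows "(torsal I L V \<and> \<not> coplanar (V ` D) \<longleftrightarrow>
           minding_isometric I L D f1 f2 \<and> \<not> trivially_isometric D f1 f2 \<and>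
           equal_winding p e \<Omega> f1 f2)
    \<and> (coplanar (V ` D) \<longrightarrow> trivially_isometric D f1 f2)
    \<and> (minding_isometric I L D f1 f2 \<longrightarrow>
         ruling_preserving_velocity_diagram I L D (graph (\<lambda>q. (f1 q + f2 q) / 2)) V)
    \<and> (torsal I L V \<longrightarrow>
         (type_I I L \<longrightarrow> tangent_surface I L V) \<and>
         (type_II I L \<longrightarrow> cone_surface I L V) \<and>
         (type_III I L \<longrightarrow> nonisotropic_cylinder I L V))"
proof (intro conjI)
  have D: "open D" "D \<noteq> {}"
    using open_ruled_domain[OF family] by (simp_all add: D_def)
  have aff: "affine_along_rulings p e \<Omega> f1" "affine_along_rulings p e \<Omega> f2"
    using ruled_graph_imp_affine[OF family] ruled by (auto simp: I_def L_def)
  have affV: "affine_along_rulings p e \<Omega> (\<lambda>q. f1 q - f2 q)"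
    using affine_along_rulings_combine[OF aff, of 1 "-1"] by simp
  have affM: "affine_along_rulings p e \<Omega> (\<lambda>q. (f1 q + f2 q) / 2)"
    using affine_along_rulings_combine[OF aff, of "1/2" "1/2"] by (simp add: add_divide_distrib)
  note second = Ck_on_2_diff_second_order[OF smooth, unfolded D_def]
  have ruledV: "ruled I L V"
    using affine_imp_ruled_difference[OF affV] by (simp add: I_def L_def V_def)
  have inD: "q \<in> D" if "s \<in> I" "q \<in> L s" for s q
    using that by (auto simp: D_def I_def L_def ruled_domain_def)
  have torsal_gradient: "torsal I L V \<longleftrightarrow> (\<forall>s\<in>I. \<forall>q\<in>L s. \<forall>q'\<in>L s.
      gradient f1 q - gradient f2 q = gradient f1 q' - gradient f2 q')"
    using torsal_difference_iff[OF family second affV] by (simp add: I_def L_def V_def)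
  also have "\<dots> \<longleftrightarrow> (\<forall>s\<in>I. \<forall>q\<in>L s. hess f1 q (e s) (rot (e s)) = hess f2 q (e s) (rot (e s)))"
  proof (rule ball_cong[OF refl])
    fix s assume s: "s \<in> I"
    have "h \<bullet> ((hessian f1 q - hessian f2 q) *v k) = k \<bullet> ((hessian f1 q - hessian f2 q) *v h)"
      if "q \<in> D" for q h k
      using Ck_on_2_symmetric(1)[OF D(1) that smooth(1)] Ck_on_2_symmetric(1)[OF D(1) that smooth(2)]
      by (simp add: hess_eq_inner matrix_vector_mult_diff_rdistrib inner_diff_right)
    from gradient_constant_iff[OF family s[unfolded I_def] second this[unfolded D_def] affV]
    show "(\<forall>q\<in>L s. \<forall>q'\<in>L s. gradient f1 q - gradient f2 q = gradient f1 q' - gradient f2 q')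
        \<longleftrightarrow> (\<forall>q\<in>L s. hess f1 q (e s) (rot (e s)) = hess f2 q (e s) (rot (e s)))"
      by (simp add: L_def hess_eq_inner matrix_vector_mult_diff_rdistrib inner_diff_right)
  qed
  finally have torsal_iff: "torsal I L V
      \<longleftrightarrow> (\<forall>s\<in>I. \<forall>q\<in>L s. hess f1 q (e s) (rot (e s)) = hess f2 q (e s) (rot (e s)))" .
  have asymptotic: "hess f q (e s) (e s) = 0"
    if sq: "s \<in> I" "q \<in> L s" and f: "Ck_on 2 f D" "affine_along_rulings p e \<Omega> f" for f s q
  proof -
    obtain t where t: "(s, t) \<in> \<Omega>" "q = p s + t *\<^sub>R e s"
      using sq by (auto simp: L_def ruling_def)
    obtain a b where "\<And>t. (s, t) \<in> \<Omega> \<Longrightarrow> f (p s + t *\<^sub>R e s) = a + b * t"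
      using f(2) sq unfolding affine_along_rulings_def I_def by meson
    from slope_along_ruling(2)[OF family Ck_on_2_second_order(1)[OF f(1), unfolded D_def] this t(1)]
    show ?thesis
      by (simp add: hess_eq_inner t(2))
  qed
  have isometric_iff: "isotropically_isometric D f1 f2
      \<longleftrightarrow> (\<forall>s\<in>I. \<forall>q\<in>L s. (hess f1 q (e s) (rot (e s)))\<^sup>2 = (hess f2 q (e s) (rot (e s)))\<^sup>2)"
  proof -
    have "graph_curvature f1 q = graph_curvature f2 q
        \<longleftrightarrow> (hess f1 q (e s) (rot (e s)))\<^sup>2 = (hess f2 q (e s) (rot (e s)))\<^sup>2"
      if sq: "s \<in> I" "q \<in> L s" for s q
    proof -
      have "e s \<noteq> 0"
        using ruling_family_nonzero[OF family] sq(1) by (simp add: I_def)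
      then have "(e s \<bullet> e s)\<^sup>2 \<noteq> 0"
        by simp
      moreover note curvature_along_asymptotic[OF D(1) inD[OF sq] smooth(1) asymptotic[OF sq smooth(1) aff(1)]]
        curvature_along_asymptotic[OF D(1) inD[OF sq] smooth(2) asymptotic[OF sq smooth(2) aff(2)]]
      ultimately show ?thesis
        by (metis mult_right_cancel neg_equal_iff_equal)
    qed
    moreover have "D = (\<Union>s\<in>I. L s)"
      by (simp add: D_def I_def L_def ruled_domain_def)
    ultimately show ?thesis
      unfolding isotropically_isometric_def by blast
  qed
  have minding_iff: "minding_isometric I L D f1 f2 \<longleftrightarrow> isotropically_isometric D f1 f2"
    using ruled by (simp add: minding_isometric_def)
  have torsal_minding: "torsal I L V \<longleftrightarrow> minding_isometric I L D f1 f2 \<and> equal_winding p e \<Omega> f1 f2"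
  proof -
    \<comment> \<open>Opposite mixed entries have a nonnegative product only if both vanish.\<close>
    have "x = y \<longleftrightarrow> x\<^sup>2 = y\<^sup>2 \<and> 0 \<le> x * y" for x y :: real
      by (auto simp: power2_eq_iff mult_le_0_iff)
    then show ?thesis
      unfolding torsal_iff minding_iff isometric_iff equal_winding_def I_def[symmetric] L_def[symmetric]
      by blast
  qed
  have coplanar_iff: "coplanar (V ` D) \<longleftrightarrow> trivially_isometric D f1 f2"
    using coplanar_difference_iff[OF D] trivially_isometric_iff[OF D smooth] by (simp add: V_def)
  show "torsal I L V \<and> \<not> coplanar (V ` D) \<longleftrightarrow>
           minding_isometric I L D f1 f2 \<and> \<not> trivially_isometric D f1 f2 \<and>
           equal_winding p e \<Omega> f1 f2"
    using torsal_minding coplanar_iff by blast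
  show "coplanar (V ` D) \<longrightarrow> trivially_isometric D f1 f2"
    using coplanar_iff by blast
  show "minding_isometric I L D f1 f2 \<longrightarrow>
         ruling_preserving_velocity_diagram I L D (graph (\<lambda>q. (f1 q + f2 q) / 2)) V"
    using affine_imp_ruled_graph[OF affM] ruledV velocity_diagram_difference[OF D(1) smooth]
    by (simp add: minding_isometric_def ruling_preserving_velocity_diagram_def I_def L_def V_def)
  show "torsal I L V \<longrightarrow>
         (type_I I L \<longrightarrow> tangent_surface I L V) \<and>
         (type_II I L \<longrightarrow> cone_surface I L V) \<and>
         (type_III I L \<longrightarrow> nonisotropic_cylinder I L V)"
  proof
    assume "torsal I L V"
    then have const: "\<forall>s\<in>fst ` \<Omega>. \<forall>q\<in>ruling p e \<Omega> s. \<forall>q'\<in>ruling p e \<Omega> s.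
        gradient f1 q - gradient f2 q = gradient f1 q' - gradient f2 q'"
      unfolding torsal_gradient unfolding I_def L_def .
    obtain N N' k k' where env:
      "\<forall>s\<in>fst ` \<Omega>. (N has_vector_derivative N' s) (at s)"
      "\<forall>s\<in>fst ` \<Omega>. (k has_real_derivative k' s) (at s)"
      "\<forall>s\<in>fst ` \<Omega>. N' s \<bullet> e s = 0"
      "\<forall>s\<in>fst ` \<Omega>. N' s \<bullet> p s + k' s = 0"
      "\<forall>s\<in>fst ` \<Omega>. \<forall>q\<in>ruling p e \<Omega> s. f1 q - f2 q = N s \<bullet> q + k s"
      by (rule constant_gradient_envelope[OF family second affV const])
    have "\<forall>s\<in>fst ` \<Omega>. \<forall>q\<in>ruling p e \<Omega> s. V q = turned_lift q (N s \<bullet> q + k s)"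
      unfolding V_def difference_surface_eq_lift using env(5) by simp
    note types = envelope_types[OF family env(1-4) this, folded I_def L_def]
    show "(type_I I L \<longrightarrow> tangent_surface I L V) \<and> (type_II I L \<longrightarrow> cone_surface I L V) \<and>
         (type_III I L \<longrightarrow> nonisotropic_cylinder I L V)"
    proof (intro conjI impI)
      show "tangent_surface I L V" if "type_I I L"
        using that by (rule types(1))
      show "cone_surface I L V" if "type_II I L"
        unfolding cone_surface_def using ruledV types(2)[OF that] by (rule conjI)
      show "nonisotropic_cylinder I L V" if "type_III I L"
        using that by (rule types(3))
    qed
  qed
qed

end
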